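(* The semigroup $\mathcal B_4$ of bounded ratios for $4\times 4$ positive definite matrices is generated, up to permutation and complementation, by positive powers of the five ratios $$\frac{\{12\}\,\emptyset}{\{1\}\{2\}},\qquad \frac{\{123\}\{1\}}{\{12\}\{13\}},\qquad R_1=\frac{\{124\}\{134\}\{23\}\{1\}\{4\}}{\{12\}\{13\}\{14\}\{24\}\{34\}},$$ $$R_2=\frac{\{1234\}\{1234\}\{23\}\{24\}\{34\}\{1\}\,\emptyset}{\{123\}\{124\}\{134\}\{234\}\{2\}\{3\}\{4\}},\qquad R_3=\frac{\{1234\}\{23\}\{24\}\{34\}\{1\}\{1\}\,\emptyset}{\{234\}\{12\}\{13\}\{14\}\{2\}\{3\}\{4\}}.$$ That is, $\mathcal B_4$ is exactly the set of finite products of positive real powers of the ratios obtained from these five by permuting the indices $1,2,3,4$ and/or replacing every index set $S$ by its complement $\{1,2,3,4\}\setminus S$.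
   Context: Let $N=\{1,2,3,4\}$. Matrices are complex; positive definite (PD) matrices are Hermitian. For a $4\times4$ matrix $A$ and $S\subseteq N$, $A[S]$ is the principal submatrix in rows and columns $S$, with $\det A[\emptyset]=1$. Given finitely many index sets $\alpha_1,\dots,\alpha_p\subseteq N$ and exponents $\eta_1,\dots,\eta_p>0$ put $\alpha(A)=\prod_{i=1}^p(\det A[\alpha_i])^{\eta_i}$, also abbreviated $\alpha_1^{\eta_1}\cdots\alpha_p^{\eta_p}$ with exponents equal to $1$ omitted; thus the index set $\{123\}=\{1,2,3\}$ stands for $\det A[\{1,2,3\}]$, etc. A ratio $\frac{\alpha}{\beta}$ is the function $A\mapsto\alpha(A)/\beta(A)$ on $4\times 4$ PD matrices, for two such products $\alpha,\beta$. Ratios are identified when each nonempty subset of $N$ has the same overall exponent (numerator minus denominator) in both; the exponent of $\emptyset$ is normalized so that all exponents sum to $0$. The empty product (the trivial ratio $1$) is included. A ratio is bounded if it has an upper bound independent of the PD matrix $A$; $\mathcal B_4$ is the set of bounded ratios, a semigroup under multiplication. *)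

theory Defs
  imports
    "Jordan_Normal_Form.DL_Submatrix"
    "Jordan_Normal_Form.Determinant"
    "Jordan_Normal_Form.Schur_Decomposition"
    "HOL-Combinatorics.Permutations"
    Complex_Main
begin

definition idx :: "nat set" where
  "idx = {1, 2, 3, 4}"

definition positive_definite :: "nat \<Rightarrow> complex mat \<Rightarrow> bool" where
  "positive_definite n A \<longleftrightarrow>
     A \<in> carrier_mat n n \<and> mat_adjoint A = A \<and>
     (\<forall>v \<in> carrier_vec n. v \<noteq> 0\<^sub>v n \<longrightarrow> 0 < Re ((A *\<^sub>v v) \<bullet>c v))"

(* Index sets are subsets of {1,...,n}, whereas rows and columns of a matrix are numbered from 0.
   The real part loses nothing: principal minors of Hermitian matrices are real.
   For S = {} the submatrix is 0 x 0 and its determinant is 1. *)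
definition principal_minor :: "complex mat \<Rightarrow> nat set \<Rightarrow> real" where
  "principal_minor A S = Re (det (submatrix A {i. Suc i \<in> S} {i. Suc i \<in> S}))"

(* [(S1, e1), ..., (Sp, ep)] stands for the product of the (det A[Si]) powr ei. *)
type_synonym minor_product = "(nat set \<times> real) list"

definition minor_products :: "minor_product set" where
  "minor_products = {\<alpha>. \<forall>(S, \<eta>) \<in> set \<alpha>. S \<subseteq> idx \<and> \<eta> > 0}"

definition eval_product :: "minor_product \<Rightarrow> complex mat \<Rightarrow> real" where
  "eval_product \<alpha> A = (\<Prod>(S, \<eta>) \<leftarrow> \<alpha>. principal_minor A S powr \<eta>)"

(* (numerator, denominator) *)
type_synonym minor_ratio = "minor_product \<times> minor_product"

definition eval_ratio :: "minor_ratio \<Rightarrow> complex mat \<Rightarrow> real" where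
  "eval_ratio r A = eval_product (fst r) A / eval_product (snd r) A"

definition bounded_ratio :: "minor_ratio \<Rightarrow> bool" where
  "bounded_ratio r \<longleftrightarrow> (\<exists>C. \<forall>A. positive_definite 4 A \<longrightarrow> eval_ratio r A \<le> C)"

definition product_exponent :: "minor_product \<Rightarrow> nat set \<Rightarrow> real" where
  "product_exponent \<alpha> S = (\<Sum>(T, \<eta>) \<leftarrow> \<alpha>. if T = S then \<eta> else 0)"

definition overall_exponent :: "minor_ratio \<Rightarrow> nat set \<Rightarrow> real" where
  "overall_exponent r S = product_exponent (fst r) S - product_exponent (snd r) S"

(* Canonical form of a ratio up to identification: two ratios are identified iff their overall
   exponents agree on all nonempty index sets, and the exponent of the empty set is replaced by
   the one that makes all exponents sum to 0. *)
definition ratio_class :: "minor_ratio \<Rightarrow> nat set \<Rightarrow> real" where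
  "ratio_class r S =
     (if S = {} then - (\<Sum>T \<in> Pow idx - {{}}. overall_exponent r T) else overall_exponent r S)"

definition bounded_ratios4 :: "(nat set \<Rightarrow> real) set" where
  "bounded_ratios4 = ratio_class ` {r \<in> minor_products \<times> minor_products. bounded_ratio r}"

definition ratio_mult :: "minor_ratio \<Rightarrow> minor_ratio \<Rightarrow> minor_ratio" where
  "ratio_mult r s = (fst r @ fst s, snd r @ snd s)"

definition ratio_power :: "minor_ratio \<Rightarrow> real \<Rightarrow> minor_ratio" where
  "ratio_power r t =
     (map (\<lambda>(S, \<eta>). (S, t * \<eta>)) (fst r), map (\<lambda>(S, \<eta>). (S, t * \<eta>)) (snd r))"

inductive_set power_products :: "minor_ratio set \<Rightarrow> minor_ratio set"
  for G :: "minor_ratio set" where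
  one: "([], []) \<in> power_products G"
| mult: "g \<in> G \<Longrightarrow> t > 0 \<Longrightarrow> r \<in> power_products G \<Longrightarrow>
    ratio_mult (ratio_power g t) r \<in> power_products G"

definition plain_ratio :: "nat set list \<Rightarrow> nat set list \<Rightarrow> minor_ratio" where
  "plain_ratio num den = (map (\<lambda>S. (S, 1)) num, map (\<lambda>S. (S, 1)) den)"

definition basic_ratios :: "minor_ratio set" where
  "basic_ratios = {
     plain_ratio [{1,2}, {}] [{1}, {2}],
     plain_ratio [{1,2,3}, {1}] [{1,2}, {1,3}],
     plain_ratio [{1,2,4}, {1,3,4}, {2,3}, {1}, {4}] [{1,2}, {1,3}, {1,4}, {2,4}, {3,4}],
     plain_ratio [{1,2,3,4}, {1,2,3,4}, {2,3}, {2,4}, {3,4}, {1}, {}]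
                 [{1,2,3}, {1,2,4}, {1,3,4}, {2,3,4}, {2}, {3}, {4}],
     plain_ratio [{1,2,3,4}, {2,3}, {2,4}, {3,4}, {1}, {1}, {}]
                 [{2,3,4}, {1,2}, {1,3}, {1,4}, {2}, {3}, {4}]}"

definition reindex :: "(nat set \<Rightarrow> nat set) \<Rightarrow> minor_ratio \<Rightarrow> minor_ratio" where
  "reindex f r = (map (\<lambda>(S, \<eta>). (f S, \<eta>)) (fst r), map (\<lambda>(S, \<eta>). (f S, \<eta>)) (snd r))"

definition index_symmetries :: "(nat set \<Rightarrow> nat set) set" where
  "index_symmetries =
     {\<lambda>S. \<sigma> ` S | \<sigma>. \<sigma> permutes idx} \<union> {\<lambda>S. idx - \<sigma> ` S | \<sigma>. \<sigma> permutes idx}"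

definition generators4 :: "minor_ratio set" where
  "generators4 = {reindex f r | f r. f \<in> index_symmetries \<and> r \<in> basic_ratios}"

end

theory Submission
  imports Defs
begin

text \<open>Taking logarithms turns a ratio into a linear functional of the numbers
\<open>ln (det A[S])\<close>, so the exponent vectors of the bounded ratios form a convex cone. It has to be
shown that this cone is spanned by the 46 exponent vectors in the orbits of the five basic ratios.

\<^bold>\<open>The generators are bounded.\<close> Let \<open>d S = det A[S]\<close>. Two families of inequalities suffice,
Koteljanskii's inequality \<open>d (Tij) d T \<le> d (Ti) d (Tj)\<close> and the triangle inequality
\<open>d (Tjk) d (Ti) \<le> 2 (d (Tij) d (Tk) + d (Tik) d (Tj))\<close>. For \<open>T = {}\<close> and a Gram matrix of unit vectors
the latter bounds the squared sine of one angle of a triple by the squared sines of the other two; a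
Schur complement reduces nonempty \<open>T\<close> to this case. Both families are preserved by permutations
of the indices and by complementation of all index sets, hence so is everything derived from them
(predicate \<open>minor_like\<close>). It remains to bound the five basic ratios, each by multiplying a few of
these inequalities.

\<^bold>\<open>There are no other bounded ratios.\<close> If positive definite matrices \<open>A\<^sub>t\<close> satisfy
\<open>det A\<^sub>t[S] \<approx> t powr w S\<close> up to constant factors, the exponents \<open>e\<close> of a bounded ratio
satisfy \<open>\<Sum>S. e S * w S \<le> 0\<close> (lemma \<open>bounded_ratio_growth\<close>). The matrices used are perturbations of the
identity by one or two rank one matrices. In the coordinates \<open>f K = \<Sum>S\<supseteq>K. e S\<close> they show that
\<open>f\<close> vanishes on sets with fewer than two elements, and, writing \<open>a ij = f {i, j}\<close>,
\<open>b l = f ({1,2,3,4} - {l})\<close> and \<open>c = f {1,2,3,4}\<close>, that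

\<^item> \<open>a, b, c \<ge> 0\<close>,
\<^item> \<open>b 1 + b 2 + b 3 + b 4 \<ge> 2 c\<close>,
\<^item> \<open>a ij + b i + b j \<ge> c\<close> for the six pairs,
\<^item> \<open>a ij + a ik + a jk \<ge> b l\<close> for the four triples,
\<^item> the sum of all \<open>a ij\<close> plus \<open>c\<close> is at least the sum of all \<open>b l\<close>.

These 23 inequalities define a cone in dimension 11. Starting from the orthant and intersecting
with the other 12 half spaces one after the other, the double description method computes its
generators. This computation is carried out inside the logic by a procedure proved to be sound, and
its result consists of the exponent vectors of the 46 generators.\<close>

section \<open>Determinants indexed by subsets\<close>

text \<open>The determinant of a submatrix renumbers rows and columns. Indexing permutations by the set itself
makes the minors for different index sets polynomials in the same entries, so that they can be related
to each other without any bookkeeping of positions.\<close>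

definition index_det :: "nat set \<Rightarrow> (nat \<Rightarrow> nat \<Rightarrow> complex) \<Rightarrow> complex" where
  "index_det I f = (\<Sum>p | p permutes I. of_int (sign p) * (\<Prod>i\<in>I. f i (p i)))"

text \<open>Conjugation with the renumbering is a sign preserving bijection between the permutations of the
positions and those of the index set.\<close>

lemma det_eq_index_det:
  assumes A: "A \<in> carrier_mat n n" and h: "bij_betw h {0..<n} I"
    and f: "\<And>i j. i < n \<Longrightarrow> j < n \<Longrightarrow> A $$ (i, j) = f (h i) (h j)"
  shows "det A = index_det I f"
proof -
  let ?N = "{0..<n}"
  let ?g = "inv_into ?N h"
  have g: "bij_betw ?g I ?N" using h by (rule bij_betw_inv_into)
  have gh: "?g (h x) = x" if "x \<in> ?N" for x using h that by (simp add: bij_betw_def)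
  have hg: "h (?g y) = y" if "y \<in> I" for y using h that by (simp add: bij_betw_inv_into_right)
  have "det A = (\<Sum>p | p permutes ?N. signof p * (\<Prod>i\<in>?N. A $$ (i, p i)))"
    using A by (rule det_def')
  also have "\<dots> = index_det I f"
    unfolding index_det_def
  proof (rule sum.reindex_bij_witness[of _ "map_permutation I ?g" "map_permutation ?N h"])
    fix p assume "p \<in> {p. p permutes ?N}"
    then have p: "p permutes ?N" by simp
    show "map_permutation I ?g (map_permutation ?N h p) = p"
      by (rule map_permutation_compose_inv[OF h p gh])
    show "map_permutation ?N h p \<in> {p. p permutes I}"
      using map_permutation_permutes[OF h p] by simp
    have inj: "inj_on h ?N" using h by (rule bij_betw_imp_inj_on)
    have "(\<Prod>i\<in>I. f i (map_permutation ?N h p i)) = (\<Prod>i\<in>?N. f (h i) (map_permutation ?N h p (h i)))"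
      by (rule prod.reindex_bij_betw[OF h, symmetric])
    also have "\<dots> = (\<Prod>i\<in>?N. A $$ (i, p i))"
    proof (rule prod.cong[OF refl])
      fix i assume i: "i \<in> ?N"
      then have "p i \<in> ?N" using p by (simp add: permutes_in_image)
      then show "f (h i) (map_permutation ?N h p (h i)) = A $$ (i, p i)"
        using i f map_permutation_apply[OF inj i, of p] by simp
    qed
    finally show "of_int (sign (map_permutation ?N h p)) * (\<Prod>i\<in>I. f i (map_permutation ?N h p i)) =
        signof p * (\<Prod>i\<in>?N. A $$ (i, p i))"
      using sign_map_permutation[OF inj p] by (simp add: sign_def)
  next
    fix p assume "p \<in> {p. p permutes I}"
    then have p: "p permutes I" by simp
    show "map_permutation ?N h (map_permutation I ?g p) = p"
      by (rule map_permutation_compose_inv[OF g p hg])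
    show "map_permutation I ?g p \<in> {p. p permutes ?N}"
      using map_permutation_permutes[OF g p] by simp
  qed
  finally show ?thesis .
qed

text \<open>Rows and columns are counted from 1 here, as in the index sets.\<close>

definition entries :: "complex mat \<Rightarrow> nat \<Rightarrow> nat \<Rightarrow> complex" where
  "entries A i j = A $$ (i - 1, j - 1)"

lemma principal_minor_eq_index_det:
  assumes A: "A \<in> carrier_mat 4 4" and S: "S \<subseteq> idx"
  shows "principal_minor A S = Re (index_det S (entries A))"
proof -
  let ?J = "{i. Suc i \<in> S}"
  have S4: "S \<subseteq> {1..4}" using S by (auto simp: idx_def)
  have fin: "finite S" using S4 finite_subset by blast
  have J: "{i. i < 4 \<and> i \<in> ?J} = ?J" using S4 by auto
  have SJ: "S = Suc ` ?J"
  proof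
    show "S \<subseteq> Suc ` ?J"
    proof
      fix x assume "x \<in> S"
      then have "Suc (x - 1) \<in> S" "x = Suc (x - 1)" using S4 by (force+)
      then show "x \<in> Suc ` ?J" by blast
    qed
  qed auto
  define h where "h i = Suc (pick ?J i)" for i
  have inj: "inj_on h {0..<card ?J}"
  proof (rule inj_onI)
    fix x y assume xy: "x \<in> {0..<card ?J}" "y \<in> {0..<card ?J}" "h x = h y"
    then have "pick ?J x = pick ?J y" by (simp add: h_def)
    then have "card {a \<in> ?J. a < pick ?J x} = card {a \<in> ?J. a < pick ?J y}" by simp
    then show "x = y" using card_pick_le[of x ?J] card_pick_le[of y ?J] xy by simp
  qed
  have "card (h ` {0..<card ?J}) = card S"
    using card_image[OF inj] card_image[of Suc ?J] SJ by simp
  moreover have "h ` {0..<card ?J} \<subseteq> S" using pick_in_set_le[of _ ?J] by (auto simp: h_def)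
  ultimately have "h ` {0..<card ?J} = S" using fin by (simp add: card_subset_eq)
  then have bij: "bij_betw h {0..<card ?J} S" using inj by (simp add: bij_betw_def)
  have "submatrix A ?J ?J \<in> carrier_mat (card ?J) (card ?J)"
    using A J by (simp add: submatrix_def)
  then have "det (submatrix A ?J ?J) = index_det S (entries A)"
    by (rule det_eq_index_det[OF _ bij]) (use A J in \<open>simp add: submatrix_def entries_def h_def\<close>)
  then show ?thesis by (simp add: principal_minor_def)
qed

lemma index_det_0: "index_det {} f = 1"
  by (simp add: index_det_def sign_id)

lemma index_det_1: "index_det {a} f = f a a"
  by (simp add: index_det_def permutes_sing sign_id)

text \<open>Laplace expansion along row \<open>a\<close>. A permutation of \<open>insert a I\<close> is a permutation of \<open>I\<close> followed by
the transposition of \<open>a\<close> with some \<open>b\<close>; this transposition puts column \<open>a\<close> in the place of column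
\<open>b\<close> and accounts for the sign.\<close>

lemma index_det_insert:
  assumes I: "finite I" "a \<notin> I"
  shows "index_det (insert a I) f =
    (\<Sum>b\<in>insert a I. (if b = a then 1 else -1) * f a b * index_det I (\<lambda>i j. f i (transpose a b j)))"
  unfolding index_det_def sum_over_permutations_insert[OF I] sum_distrib_left
proof (intro sum.cong refl)
  fix b p assume b: "b \<in> insert a I" and "p \<in> {p. p permutes I}"
  then have p: "p permutes I" by simp
  have pa: "p a = a" using p I(2) by (simp add: permutes_not_in)
  have "permutation p" using p I(1) permutation_permutes by blast
  then have "sign (transpose a b \<circ> p) = (if b = a then 1 else -1) * sign p"
    by (simp add: sign_compose permutation_swap_id sign_swap_id)
  moreover have "(\<Prod>i\<in>insert a I. f i ((transpose a b \<circ> p) i)) =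
      f a b * (\<Prod>i\<in>I. f i (transpose a b (p i)))"
    using I by (simp add: pa)
  ultimately show "of_int (sign (transpose a b \<circ> p)) * (\<Prod>i\<in>insert a I. f i ((transpose a b \<circ> p) i)) =
      (if b = a then 1 else -1) * f a b * (of_int (sign p) * (\<Prod>i\<in>I. f i (transpose a b (p i))))"
    by simp
qed

lemma index_det_2:
  assumes "a \<noteq> b"
  shows "index_det {a, b} f = f a a * f b b - f a b * f b a"
  using assms by (simp add: index_det_insert index_det_1)

lemma index_det_3:
  assumes "distinct [a, b, c]"
  shows "index_det {a, b, c} f =
    f a a * (f b b * f c c - f b c * f c b) - f a b * (f b a * f c c - f b c * f c a)
    - f a c * (f b b * f c a - f b a * f c b)"
proof -
  have "index_det {a, b, c} f = f a a * index_det {b, c} f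
      - f a b * index_det {b, c} (\<lambda>i j. f i (transpose a b j))
      - f a c * index_det {b, c} (\<lambda>i j. f i (transpose a c j))"
    using assms by (simp add: index_det_insert[of "{b, c}"])
  also have "\<dots> = f a a * (f b b * f c c - f b c * f c b) - f a b * (f b a * f c c - f b c * f c a)
    - f a c * (f b b * f c a - f b a * f c b)"
    using assms by (simp add: index_det_2 transpose_def)
  finally show ?thesis .
qed

lemma index_det_4:
  assumes "distinct [a, b, c, d]"
  shows "index_det {a, b, c, d} f =
      f a a * (f b b * (f c c * f d d - f c d * f d c) - f b c * (f c b * f d d - f c d * f d b)
        - f b d * (f c c * f d b - f c b * f d c))
    - f a b * (f b a * (f c c * f d d - f c d * f d c) - f b c * (f c a * f d d - f c d * f d a)
        - f b d * (f c c * f d a - f c a * f d c))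
    - f a c * (f b b * (f c a * f d d - f c d * f d a) - f b a * (f c b * f d d - f c d * f d b)
        - f b d * (f c a * f d b - f c b * f d a))
    - f a d * (f b b * (f c c * f d a - f c a * f d c) - f b c * (f c b * f d a - f c a * f d b)
        - f b a * (f c c * f d b - f c b * f d c))"
proof -
  have bcd: "distinct [b, c, d]" using assms by simp
  have "index_det {a, b, c, d} f = f a a * index_det {b, c, d} f
      - f a b * index_det {b, c, d} (\<lambda>i j. f i (transpose a b j))
      - f a c * index_det {b, c, d} (\<lambda>i j. f i (transpose a c j))
      - f a d * index_det {b, c, d} (\<lambda>i j. f i (transpose a d j))"
    using assms by (simp add: index_det_insert[of "{b, c, d}"])
  then show ?thesis
    unfolding index_det_3[OF bcd] using assms by (simp add: transpose_def)
qed

section \<open>Hermitian forms and Schur complements\<close>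

text \<open>Positive definiteness of a Hermitian form in the coordinates \<open>I\<close>. It passes to subsets of \<open>I\<close> and to
Schur complements, which is how all properties of the minors are obtained below.\<close>

definition herm_pd :: "nat set \<Rightarrow> (nat \<Rightarrow> nat \<Rightarrow> complex) \<Rightarrow> bool" where
  "herm_pd I f \<longleftrightarrow> finite I \<and> (\<forall>i\<in>I. \<forall>j\<in>I. f j i = cnj (f i j)) \<and>
     (\<forall>x. (\<exists>i\<in>I. x i \<noteq> 0) \<longrightarrow> 0 < Re (\<Sum>i\<in>I. \<Sum>j\<in>I. f i j * x j * cnj (x i)))"

lemma herm_pdD:
  assumes "herm_pd I f"
  shows "finite I"
    and "\<And>i j. i \<in> I \<Longrightarrow> j \<in> I \<Longrightarrow> f j i = cnj (f i j)"
    and "\<And>x. \<exists>i\<in>I. x i \<noteq> 0 \<Longrightarrow> 0 < Re (\<Sum>i\<in>I. \<Sum>j\<in>I. f i j * x j * cnj (x i))"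
proof -
  note pd = assms[unfolded herm_pd_def]
  show "finite I" using pd by (rule conjunct1)
  show "\<And>i j. i \<in> I \<Longrightarrow> j \<in> I \<Longrightarrow> f j i = cnj (f i j)"
    using pd[THEN conjunct2, THEN conjunct1] by blast
  show "\<And>x. \<exists>i\<in>I. x i \<noteq> 0 \<Longrightarrow> 0 < Re (\<Sum>i\<in>I. \<Sum>j\<in>I. f i j * x j * cnj (x i))"
    using pd[THEN conjunct2, THEN conjunct2] by blast
qed

lemma herm_pd_subset:
  assumes "herm_pd I f" "J \<subseteq> I"
  shows "herm_pd J f"
  unfolding herm_pd_def
proof (intro conjI allI impI)
  have fin: "finite I" using herm_pdD(1)[OF assms(1)] .
  then show "finite J" using assms(2) finite_subset by blast
  show "\<forall>i\<in>J. \<forall>j\<in>J. f j i = cnj (f i j)" using herm_pdD(2)[OF assms(1)] assms(2) by blast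
  fix x :: "nat \<Rightarrow> complex" assume nz: "\<exists>i\<in>J. x i \<noteq> 0"
  define y where "y i = (if i \<in> J then x i else 0)" for i
  have "0 < Re (\<Sum>i\<in>I. \<Sum>j\<in>I. f i j * y j * cnj (y i))"
  proof -
    have "\<exists>i\<in>I. y i \<noteq> 0" using nz assms(2) by (auto simp: y_def)
    then show ?thesis by (rule herm_pdD(3)[OF assms(1)])
  qed
  also have "(\<Sum>i\<in>I. \<Sum>j\<in>I. f i j * y j * cnj (y i)) = (\<Sum>i\<in>J. \<Sum>j\<in>I. f i j * y j * cnj (y i))"
    by (rule sum.mono_neutral_right[OF fin assms(2)]) (simp add: y_def)
  also have "\<dots> = (\<Sum>i\<in>J. \<Sum>j\<in>J. f i j * y j * cnj (y i))"
    by (intro sum.cong refl sum.mono_neutral_right[OF fin assms(2)]) (simp add: y_def)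
  also have "\<dots> = (\<Sum>i\<in>J. \<Sum>j\<in>J. f i j * x j * cnj (x i))"
    by (intro sum.cong refl) (simp add: y_def)
  finally show "0 < Re (\<Sum>i\<in>J. \<Sum>j\<in>J. f i j * x j * cnj (x i))" .
qed

lemma herm_pd_diag:
  assumes "herm_pd I f" "i \<in> I"
  obtains a where "a > 0" "f i i = of_real a"
proof -
  have "herm_pd {i} f" using assms herm_pd_subset by blast
  then have "0 < Re (f i i)" "f i i = cnj (f i i)"
    unfolding herm_pd_def by (fastforce dest: spec[of _ "\<lambda>_. 1"])+
  then show thesis using that[of "Re (f i i)"] by (metis Reals_cnj_iff of_real_Re)
qed

text \<open>The Schur complement of the pivot \<open>(l, l)\<close>, multiplied by the pivot. Without the division its minors
are, up to powers of the pivot, the minors containing \<open>l\<close> of the original form; see \<open>schur_det_1\<close> to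
\<open>schur_det_3\<close>.\<close>

definition schur :: "nat \<Rightarrow> (nat \<Rightarrow> nat \<Rightarrow> complex) \<Rightarrow> nat \<Rightarrow> nat \<Rightarrow> complex" where
  "schur l f i j = f l l * f i j - f i l * f l j"

text \<open>Extending a vector on \<open>I\<close> by the coordinate at \<open>l\<close> that minimises the form, the value of the form
becomes that of the Schur complement divided by the pivot.\<close>

lemma herm_pd_schur:
  assumes pd: "herm_pd (insert l I) f" and l: "l \<notin> I"
  shows "herm_pd I (schur l f)"
  unfolding herm_pd_def
proof (intro conjI allI impI)
  have fin: "finite I" using herm_pdD(1)[OF pd] by simp
  then show "finite I" .
  have herm: "f j i = cnj (f i j)" if "i \<in> insert l I" "j \<in> insert l I" for i j
    by (rule herm_pdD(2)[OF pd that])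
  obtain a where a: "a > 0" "f l l = of_real a" by (rule herm_pd_diag[OF pd insertI1])
  show "\<forall>i\<in>I. \<forall>j\<in>I. schur l f j i = cnj (schur l f i j)"
  proof (intro ballI)
    fix i j assume ij: "i \<in> I" "j \<in> I"
    have "f j i = cnj (f i j)" "f j l = cnj (f l j)" "f l i = cnj (f i l)"
      by (rule herm; use ij in simp)+
    then show "schur l f j i = cnj (schur l f i j)" by (simp add: schur_def a)
  qed
  fix x :: "nat \<Rightarrow> complex" assume nz: "\<exists>i\<in>I. x i \<noteq> 0"
  define s where "s = (\<Sum>j\<in>I. f l j * x j)"
  \<comment> \<open>This value makes row \<open>l\<close> of the form vanish.\<close>
  define y where "y = x(l := - s / of_real a)"
  have yx: "y i = x i" if "i \<in> I" for i using that l by (auto simp: y_def)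
  have yl: "of_real a * y l = - s" using a by (simp add: y_def)
  have "0 < Re (\<Sum>i\<in>insert l I. \<Sum>j\<in>insert l I. f i j * y j * cnj (y i))"
  proof -
    have "\<exists>i\<in>insert l I. y i \<noteq> 0" using nz yx by auto
    then show ?thesis by (rule herm_pdD(3)[OF pd])
  qed
  then have pos: "0 < Re (of_real a * (\<Sum>i\<in>insert l I. \<Sum>j\<in>insert l I. f i j * y j * cnj (y i)))"
    using a by simp
  have row: "(\<Sum>j\<in>insert l I. f l j * y j * cnj (y l)) = 0"
  proof -
    have "(\<Sum>j\<in>insert l I. f l j * y j * cnj (y l)) = (of_real a * y l + s) * cnj (y l)"
      using fin l a yx by (simp add: s_def sum_distrib_right distrib_right)
    then show ?thesis using yl by simp
  qed
  have rest: "of_real a * (\<Sum>j\<in>insert l I. f i j * y j * cnj (y i)) =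
      (\<Sum>j\<in>I. schur l f i j * x j * cnj (x i))" if i: "i \<in> I" for i
  proof -
    have "of_real a * (\<Sum>j\<in>insert l I. f i j * y j * cnj (y i)) =
        f i l * (of_real a * y l) * cnj (x i) + (\<Sum>j\<in>I. of_real a * f i j * x j * cnj (x i))"
      using fin l i yx by (simp add: sum_distrib_left distrib_left mult_ac)
    also have "\<dots> = (\<Sum>j\<in>I. schur l f i j * x j * cnj (x i))"
      unfolding yl s_def schur_def a(2)
      by (simp add: sum_distrib_left sum_distrib_right left_diff_distrib right_diff_distrib sum_subtractf sum_negf mult_ac)
    finally show ?thesis .
  qed
  have "of_real a * (\<Sum>i\<in>insert l I. \<Sum>j\<in>insert l I. f i j * y j * cnj (y i)) =
      (\<Sum>i\<in>I. of_real a * (\<Sum>j\<in>insert l I. f i j * y j * cnj (y i)))"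
    unfolding sum.insert[OF fin l, of "\<lambda>i. \<Sum>j\<in>insert l I. f i j * y j * cnj (y i)"] row
    by (simp only: add_0_left sum_distrib_left)
  also have "\<dots> = (\<Sum>i\<in>I. \<Sum>j\<in>I. schur l f i j * x j * cnj (x i))"
    using rest by (rule sum.cong[OF refl])
  finally show "0 < Re (\<Sum>i\<in>I. \<Sum>j\<in>I. schur l f i j * x j * cnj (x i))" using pos by simp
qed

lemma schur_det_1:
  "l \<noteq> i \<Longrightarrow> index_det {i} (schur l f) = index_det {l, i} f"
  by (simp add: index_det_1 index_det_2 schur_def)

lemma schur_det_2:
  assumes "distinct [l, i, j]"
  shows "index_det {i, j} (schur l f) = f l l * index_det {l, i, j} f"
  using assms unfolding index_det_3[OF assms] by (simp add: index_det_2 schur_def algebra_simps)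

lemma schur_det_3:
  assumes "distinct [l, i, j, k]"
  shows "index_det {i, j, k} (schur l f) = f l l ^ 2 * index_det {l, i, j, k} f"
proof -
  have ijk: "distinct [i, j, k]" using assms by simp
  show ?thesis unfolding index_det_3[OF ijk] index_det_4[OF assms] schur_def
    by (simp add: algebra_simps power2_eq_square)
qed

section \<open>Koteljanskii and triangle inequalities for principal minors\<close>

text \<open>Reality and positivity of the minors are proved together: a pivot can be cancelled from a minor of
the Schur complement only if it is known to be a positive real number.\<close>

definition pos_real :: "complex \<Rightarrow> bool" where
  "pos_real z \<longleftrightarrow> (\<exists>r>0. z = of_real r)"

lemma pos_realD: "pos_real z \<Longrightarrow> 0 < Re z \<and> z = of_real (Re z)"
  by (auto simp: pos_real_def)

lemma pos_real_cancel:
  assumes "pos_real a" "pos_real (a * z)"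
  shows "pos_real z"
proof -
  obtain r s where "r > 0" "s > 0" "a = of_real r" "a * z = of_real s"
    using assms by (auto simp: pos_real_def)
  then have "z = of_real (s / r)" "s / r > 0" by (auto simp: field_simps)
  then show ?thesis unfolding pos_real_def by blast
qed

lemma herm_pd_pos_1: "herm_pd {i} f \<Longrightarrow> pos_real (f i i)"
  by (metis herm_pd_diag insertI1 pos_real_def)

lemma herm_pd_pos_2:
  assumes "herm_pd {i, j} f" "i \<noteq> j"
  shows "pos_real (index_det {i, j} f)"
  using herm_pd_pos_1[OF herm_pd_schur[OF assms(1)]] assms(2)
  by (simp add: schur_det_1[symmetric] index_det_1)

lemma herm_pd_pos_3:
  assumes pd: "herm_pd {i, j, k} f" and d: "distinct [i, j, k]"
  shows "pos_real (index_det {i, j, k} f)"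
proof (rule pos_real_cancel)
  show "pos_real (f i i)" using herm_pd_pos_1 herm_pd_subset[OF pd, of "{i}"] by simp
  show "pos_real (f i i * index_det {i, j, k} f)"
    using herm_pd_pos_2[OF herm_pd_schur[OF pd]] d by (simp add: schur_det_2)
qed

lemma herm_pd_pos_4:
  assumes pd: "herm_pd {i, j, k, l} f" and d: "distinct [i, j, k, l]"
  shows "pos_real (index_det {i, j, k, l} f)"
proof (rule pos_real_cancel)
  show a: "pos_real (f i i)" using herm_pd_pos_1 herm_pd_subset[OF pd, of "{i}"] by simp
  have "pos_real (f i i * (f i i * index_det {i, j, k, l} f))"
    using herm_pd_pos_3[OF herm_pd_schur[OF pd]] d by (simp add: schur_det_3 power2_eq_square mult.assoc)
  then show "pos_real (f i i * index_det {i, j, k, l} f)" by (rule pos_real_cancel[OF a])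
qed

abbreviation re_det :: "nat set \<Rightarrow> (nat \<Rightarrow> nat \<Rightarrow> complex) \<Rightarrow> real" where
  "re_det S f \<equiv> Re (index_det S f)"

lemma re_det_2:
  assumes pd: "herm_pd {i, j} f" and d: "i \<noteq> j"
  shows "re_det {i, j} f = re_det {i} f * re_det {j} f - (cmod (f i j))\<^sup>2"
proof -
  have h: "f j i = cnj (f i j)" by (rule herm_pdD(2)[OF pd]) simp_all
  obtain a where "f i i = of_real a" by (rule herm_pd_diag[OF pd, of i]) simp
  moreover obtain b where "f j j = of_real b" by (rule herm_pd_diag[OF pd, of j]) simp
  ultimately show ?thesis
    using d unfolding index_det_2[OF d] index_det_1 h complex_norm_square[symmetric] by simp
qed

lemma re_det_schur:
  assumes a: "f l l = of_real a"
  shows "l \<noteq> i \<Longrightarrow> re_det {i} (schur l f) = re_det {l, i} f"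
    and "distinct [l, i, j] \<Longrightarrow> re_det {i, j} (schur l f) = a * re_det {l, i, j} f"
    and "distinct [l, i, j, k] \<Longrightarrow> re_det {i, j, k} (schur l f) = a\<^sup>2 * re_det {l, i, j, k} f"
proof -
  show "l \<noteq> i \<Longrightarrow> re_det {i} (schur l f) = re_det {l, i} f" by (simp add: schur_det_1)
  show "distinct [l, i, j] \<Longrightarrow> re_det {i, j} (schur l f) = a * re_det {l, i, j} f"
    unfolding schur_det_2 a by simp
  show "distinct [l, i, j, k] \<Longrightarrow> re_det {i, j, k} (schur l f) = a\<^sup>2 * re_det {l, i, j, k} f"
    unfolding schur_det_3 a of_real_power[symmetric] by simp
qed

text \<open>Koteljanskii's inequality for an empty common set. Replacing the form by its Schur complement with
respect to \<open>l\<close> adds \<open>l\<close> to all index sets; this yields the two lemmas that follow.\<close>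

lemma koteljanskii_0:
  assumes "herm_pd {i, j} f" "i \<noteq> j"
  shows "re_det {i, j} f \<le> re_det {i} f * re_det {j} f"
  by (simp add: re_det_2[OF assms])

lemma koteljanskii_1:
  assumes pd: "herm_pd {l, i, j} f" and d: "distinct [l, i, j]"
  shows "re_det {l, i, j} f * re_det {l} f \<le> re_det {l, i} f * re_det {l, j} f"
proof -
  obtain a where a: "a > 0" "f l l = of_real a" by (rule herm_pd_diag[OF pd, of l]) simp
  have "re_det {i, j} (schur l f) \<le> re_det {i} (schur l f) * re_det {j} (schur l f)"
    by (rule koteljanskii_0[OF herm_pd_schur[OF pd]]) (use d in auto)
  moreover have "re_det {l} f = a" by (simp add: index_det_1 a)
  ultimately show ?thesis using d by (simp add: re_det_schur[of f, OF a(2)] mult.commute)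
qed

lemma koteljanskii_2:
  assumes pd: "herm_pd {l, m, i, j} f" and d: "distinct [l, m, i, j]"
  shows "re_det {l, m, i, j} f * re_det {l, m} f \<le> re_det {l, m, i} f * re_det {l, m, j} f"
proof -
  obtain a where a: "a > 0" "f l l = of_real a" by (rule herm_pd_diag[OF pd, of l]) simp
  have "re_det {m, i, j} (schur l f) * re_det {m} (schur l f) \<le>
      re_det {m, i} (schur l f) * re_det {m, j} (schur l f)"
    by (rule koteljanskii_1[OF herm_pd_schur[OF pd]]) (use d in auto)
  then have "a\<^sup>2 * (re_det {l, m, i, j} f * re_det {l, m} f) \<le> a\<^sup>2 * (re_det {l, m, i} f * re_det {l, m, j} f)"
    using d by (simp add: re_det_schur[of f, OF a(2)] power2_eq_square mult_ac)
  then show ?thesis using a by simp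
qed

text \<open>For vectors with Gram matrix \<open>f\<close>, the entry \<open>m\<close> of the Schur complement measures the inner product of the
components of the vectors \<open>j\<close> and \<open>k\<close> orthogonal to vector \<open>i\<close>, and \<open>X\<close>, \<open>Y\<close> measure the squared
lengths of these components. So \<open>|m|\<^sup>2 \<le> X Y\<close>, and expanding the minor of \<open>j\<close> and \<open>k\<close> along
\<open>a f j k = cnj (f i j) f i k + m\<close> gives the estimate.\<close>

lemma triangle_0:
  assumes pd: "herm_pd {i, j, k} f" and d: "distinct [i, j, k]"
  shows "re_det {j, k} f * re_det {i} f \<le>
    2 * (re_det {i, j} f * re_det {k} f + re_det {i, k} f * re_det {j} f)"
proof -
  obtain a where a: "a > 0" "f i i = of_real a" by (rule herm_pd_diag[OF pd, of i]) simp
  obtain b where b: "f j j = of_real b" by (rule herm_pd_diag[OF pd, of j]) simp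
  obtain c where c: "f k k = of_real c" by (rule herm_pd_diag[OF pd, of k]) simp
  define m where "m = schur i f j k"
  define p q r \<mu> where "p = cmod (f i j)" and "q = cmod (f i k)" and "r = cmod (f j k)" and "\<mu> = cmod m"
  define X Y where "X = re_det {i, j} f" and "Y = re_det {i, k} f"
  have pd2: "herm_pd {i, j} f" "herm_pd {i, k} f" "herm_pd {j, k} f"
    by (rule herm_pd_subset[OF pd]; blast)+
  have X: "X = a * b - p\<^sup>2" "X > 0" and Y: "Y = a * c - q\<^sup>2" "Y > 0"
    and Z: "re_det {j, k} f = b * c - r\<^sup>2"
    using re_det_2[OF pd2(1)] re_det_2[OF pd2(2)] re_det_2[OF pd2(3)] d a b c
      pos_realD[OF herm_pd_pos_2[OF pd2(1)]] pos_realD[OF herm_pd_pos_2[OF pd2(2)]]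
    by (auto simp: X_def Y_def p_def q_def r_def index_det_1)
  have s: "herm_pd {j, k} (schur i f)" by (rule herm_pd_schur[OF pd]) (use d in auto)
  have mu: "\<mu>\<^sup>2 \<le> X * Y"
    using re_det_2[OF s] pos_realD[OF herm_pd_pos_2[OF s]] d
    by (simp add: schur_det_1 X_def Y_def \<mu>_def m_def)
  have "f j i = cnj (f i j)" by (rule herm_pdD(2)[OF pd]) simp_all
  then have aR: "of_real a * f j k = cnj (f i j) * f i k + m"
    by (simp add: m_def schur_def a)
  have "\<bar>cmod (cnj (f i j) * f i k) - cmod m\<bar> \<le> cmod (of_real a * f j k)"
    unfolding aR using norm_triangle_ineq3[of "cnj (f i j) * f i k" "- m"] by simp
  then have "\<bar>p * q - \<mu>\<bar> \<le> a * r"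
    using a by (simp add: p_def q_def r_def \<mu>_def norm_mult)
  then have ar: "(p * q - \<mu>)\<^sup>2 \<le> (a * r)\<^sup>2" by (simp add: abs_le_square_iff[symmetric])
  have "(2 * p * q * \<mu>)\<^sup>2 \<le> 4 * p\<^sup>2 * q\<^sup>2 * (X * Y)"
    using mult_left_mono[OF mu, of "4 * p\<^sup>2 * q\<^sup>2"] by (simp add: power_mult_distrib)
  also have "\<dots> \<le> (X * q\<^sup>2 + Y * p\<^sup>2)\<^sup>2"
    using zero_le_power2[of "X * q\<^sup>2 - Y * p\<^sup>2"] by (simp add: power2_eq_square algebra_simps)
  finally have pq: "2 * p * q * \<mu> \<le> X * q\<^sup>2 + Y * p\<^sup>2"
    by (rule power2_le_imp_le) (simp add: X(2) Y(2) less_imp_le)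
  have "a * (a * (b * c - r\<^sup>2)) = (X + p\<^sup>2) * (Y + q\<^sup>2) - (a * r)\<^sup>2"
    by (simp add: X(1) Y(1) power2_eq_square algebra_simps)
  also have "\<dots> \<le> X * Y + X * q\<^sup>2 + Y * p\<^sup>2 + 2 * p * q * \<mu>"
  proof -
    have "(p * q - \<mu>)\<^sup>2 = p\<^sup>2 * q\<^sup>2 - 2 * p * q * \<mu> + \<mu>\<^sup>2"
      "(X + p\<^sup>2) * (Y + q\<^sup>2) = X * Y + X * q\<^sup>2 + Y * p\<^sup>2 + p\<^sup>2 * q\<^sup>2"
      by (simp_all add: power2_eq_square algebra_simps)
    then show ?thesis using ar zero_le_power2[of \<mu>] by linarith
  qed
  also have "\<dots> \<le> 2 * (X * (Y + q\<^sup>2) + Y * (X + p\<^sup>2))"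
    using pq mult_pos_pos[OF X(2) Y(2)] by (simp add: algebra_simps)
  also have "\<dots> = a * (2 * (X * c + Y * b))" by (simp add: X(1) Y(1) algebra_simps)
  finally have "a * (b * c - r\<^sup>2) \<le> 2 * (X * c + Y * b)" using a by simp
  then show ?thesis unfolding Z X_def[symmetric] Y_def[symmetric] index_det_1 using a b c by (simp add: mult.commute)
qed

lemma triangle_1:
  assumes pd: "herm_pd {l, i, j, k} f" and d: "distinct [l, i, j, k]"
  shows "re_det {l, j, k} f * re_det {l, i} f \<le>
    2 * (re_det {l, i, j} f * re_det {l, k} f + re_det {l, i, k} f * re_det {l, j} f)"
proof -
  obtain a where a: "a > 0" "f l l = of_real a" by (rule herm_pd_diag[OF pd, of l]) simp
  have "re_det {j, k} (schur l f) * re_det {i} (schur l f) \<le>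
    2 * (re_det {i, j} (schur l f) * re_det {k} (schur l f) + re_det {i, k} (schur l f) * re_det {j} (schur l f))"
    by (rule triangle_0[OF herm_pd_schur[OF pd]]) (use d in auto)
  then have "a * (re_det {l, j, k} f * re_det {l, i} f) \<le>
    a * (2 * (re_det {l, i, j} f * re_det {l, k} f + re_det {l, i, k} f * re_det {l, j} f))"
    using d by (simp add: re_det_schur[of f, OF a(2)] algebra_simps)
  then show ?thesis using a by simp
qed

text \<open>All that is used about principal minors in bounding ratios. The inequalities are homogeneous, with
\<open>d {}\<close> appearing on the same footing as the other values, in order that complementing all sets maps
each of the two families to itself.\<close>

definition minor_like :: "(nat set \<Rightarrow> real) \<Rightarrow> bool" where
  "minor_like d \<longleftrightarrow>
    (\<forall>S \<subseteq> idx. 0 < d S) \<and>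
    (\<forall>T i j. insert i (insert j T) \<subseteq> idx \<and> i \<noteq> j \<and> i \<notin> T \<and> j \<notin> T \<longrightarrow>
      d (insert i (insert j T)) * d T \<le> d (insert i T) * d (insert j T)) \<and>
    (\<forall>T i j k. insert i (insert j (insert k T)) \<subseteq> idx \<and> distinct [i, j, k] \<and> {i, j, k} \<inter> T = {} \<longrightarrow>
      d (insert j (insert k T)) * d (insert i T) \<le>
        2 * (d (insert i (insert j T)) * d (insert k T) + d (insert i (insert k T)) * d (insert j T)))"

lemma minor_like_pos: "minor_like d \<Longrightarrow> S \<subseteq> idx \<Longrightarrow> 0 < d S"
  by (simp add: minor_like_def)

lemma minor_like_koteljanskii:
  assumes "minor_like d" "insert i (insert j T) \<subseteq> idx" "i \<noteq> j" "i \<notin> T" "j \<notin> T"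
  shows "d (insert i (insert j T)) * d T \<le> d (insert i T) * d (insert j T)"
  using assms unfolding minor_like_def by blast

lemma minor_like_triangle:
  assumes "minor_like d" "insert i (insert j (insert k T)) \<subseteq> idx" "distinct [i, j, k]" "{i, j, k} \<inter> T = {}"
  shows "d (insert j (insert k T)) * d (insert i T) \<le>
        2 * (d (insert i (insert j T)) * d (insert k T) + d (insert i (insert k T)) * d (insert j T))"
  using assms unfolding minor_like_def by blast

lemma minor_like_compose_perm:
  assumes d: "minor_like d" and s: "\<sigma> permutes idx"
  shows "minor_like (\<lambda>S. d (\<sigma> ` S))"
proof -
  have inj: "inj \<sigma>" using s by (rule permutes_inj)
  have sub: "\<sigma> ` S \<subseteq> idx" if "S \<subseteq> idx" for S
    using image_mono[OF that, of \<sigma>] permutes_image[OF s] by simp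
  show ?thesis
    unfolding minor_like_def
  proof (intro conjI allI impI; (elim conjE)?)
    fix S assume "S \<subseteq> idx"
    then show "0 < d (\<sigma> ` S)" using minor_like_pos[OF d sub] by blast
  next
    fix T i j assume "insert i (insert j T) \<subseteq> idx" and ne: "i \<noteq> j" "i \<notin> T" "j \<notin> T"
    then have "insert (\<sigma> i) (insert (\<sigma> j) (\<sigma> ` T)) \<subseteq> idx" using sub[of "insert i (insert j T)"] by simp
    then show "d (\<sigma> ` insert i (insert j T)) * d (\<sigma> ` T) \<le> d (\<sigma> ` insert i T) * d (\<sigma> ` insert j T)"
      using minor_like_koteljanskii[OF d] ne inj by (simp add: inj_eq inj_image_mem_iff)
  next
    fix T i j k assume "insert i (insert j (insert k T)) \<subseteq> idx"
      and ne: "distinct [i, j, k]" "{i, j, k} \<inter> T = {}"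
    then have "insert (\<sigma> i) (insert (\<sigma> j) (insert (\<sigma> k) (\<sigma> ` T))) \<subseteq> idx"
      using sub[of "insert i (insert j (insert k T))"] by simp
    then show "d (\<sigma> ` insert j (insert k T)) * d (\<sigma> ` insert i T)
       \<le> 2 * (d (\<sigma> ` insert i (insert j T)) * d (\<sigma> ` insert k T) +
              d (\<sigma> ` insert i (insert k T)) * d (\<sigma> ` insert j T))"
      using minor_like_triangle[OF d] ne inj by (simp add: inj_eq inj_image_mem_iff)
  qed
qed

text \<open>With \<open>U\<close> the complement of all indices in play, complementation exchanges the two factors on the left
of Koteljanskii's inequality, and the factors in each product of the triangle inequality.\<close>

lemma minor_like_complement:
  assumes d: "minor_like d"
  shows "minor_like (\<lambda>S. d (idx - S))"
  unfolding minor_like_def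
proof (intro conjI allI impI; (elim conjE)?)
  fix S assume "S \<subseteq> idx"
  then show "0 < d (idx - S)" using minor_like_pos[OF d] by simp
next
  fix T i j assume T: "insert i (insert j T) \<subseteq> idx" "i \<noteq> j" "i \<notin> T" "j \<notin> T"
  define U where "U = idx - insert i (insert j T)"
  have U: "idx - insert i (insert j T) = U" "idx - T = insert j (insert i U)"
    "idx - insert i T = insert j U" "idx - insert j T = insert i U"
    using T by (auto simp: U_def)
  have "insert j (insert i U) \<subseteq> idx" "j \<noteq> i" "j \<notin> U" "i \<notin> U" using T by (auto simp: U_def)
  then show "d (idx - insert i (insert j T)) * d (idx - T) \<le> d (idx - insert i T) * d (idx - insert j T)"
    unfolding U using minor_like_koteljanskii[OF d] by (metis mult.commute)
next
  fix T i j k assume T: "insert i (insert j (insert k T)) \<subseteq> idx" "distinct [i, j, k]" "{i, j, k} \<inter> T = {}"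
  define U where "U = idx - insert i (insert j (insert k T))"
  have U: "idx - insert j (insert k T) = insert i U" "idx - insert i T = insert j (insert k U)"
    "idx - insert i (insert j T) = insert k U" "idx - insert i (insert k T) = insert j U"
    "idx - insert j T = insert i (insert k U)" "idx - insert k T = insert i (insert j U)"
    using T by (auto simp: U_def)
  have "insert i (insert j (insert k U)) \<subseteq> idx" "{i, j, k} \<inter> U = {}" using T by (auto simp: U_def)
  from minor_like_triangle[OF d this(1) T(2) this(2)]
  show "d (idx - insert j (insert k T)) * d (idx - insert i T)
       \<le> 2 * (d (idx - insert i (insert j T)) * d (idx - insert k T) +
              d (idx - insert i (insert k T)) * d (idx - insert j T))"
    unfolding U by (simp add: mult.commute add.commute)
qed

lemma minor_like_symmetry:
  assumes "minor_like d" "f \<in> index_symmetries"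
  shows "minor_like (\<lambda>S. d (f S))"
  using assms minor_like_compose_perm[OF minor_like_complement] minor_like_compose_perm
  by (auto simp: index_symmetries_def)

lemma positive_definite_entries:
  assumes "positive_definite 4 A"
  shows "A \<in> carrier_mat 4 4" "herm_pd idx (entries A)"
proof -
  show A: "A \<in> carrier_mat 4 4" using assms by (simp add: positive_definite_def)
  have adj: "mat_adjoint A = A" using assms by (simp add: positive_definite_def)
  show "herm_pd idx (entries A)"
    unfolding herm_pd_def
  proof (intro conjI allI impI ballI)
    show "finite idx" by (simp add: idx_def)
    fix i j assume ij: "i \<in> idx" "j \<in> idx"
    then have "i - 1 < 4" "j - 1 < 4" by (auto simp: idx_def)
    then have "mat_adjoint A $$ (j - 1, i - 1) = cnj (A $$ (i - 1, j - 1))"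
      using A by (simp add: mat_adjoint_def mat_of_rows_index cols_nth)
    then show "entries A j i = cnj (entries A i j)" by (simp add: adj entries_def)
  next
    fix x :: "nat \<Rightarrow> complex" assume nz: "\<exists>i\<in>idx. x i \<noteq> 0"
    define v where "v = vec 4 (\<lambda>i. x (Suc i))"
    have v: "v \<in> carrier_vec 4" by (simp add: v_def)
    have "v \<noteq> 0\<^sub>v 4"
    proof
      assume "v = 0\<^sub>v 4"
      then have "x (Suc i) = 0" if "i < 4" for i
        using that by (metis index_vec index_zero_vec(1) v_def)
      from this[of 0] this[of 1] this[of 2] this[of 3] show False using nz
        by (auto simp: idx_def numeral_2_eq_2 numeral_3_eq_3 numeral_eq_Suc)
    qed
    then have "0 < Re ((A *\<^sub>v v) \<bullet>c v)" using assms v by (simp add: positive_definite_def)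
    also have "(A *\<^sub>v v) \<bullet>c v = (\<Sum>i<4. \<Sum>j<4. A $$ (i, j) * x (Suc j) * cnj (x (Suc i)))"
      using A by (simp add: scalar_prod_def v_def sum_distrib_right lessThan_atLeast0)
    also have "\<dots> = (\<Sum>i\<in>idx. \<Sum>j\<in>idx. entries A i j * x j * cnj (x i))"
      by (simp add: idx_def entries_def eval_nat_numeral)
    finally show "0 < Re (\<Sum>i\<in>idx. \<Sum>j\<in>idx. entries A i j * x j * cnj (x i))" .
  qed
qed

lemma subset_idx_list_cases:
  assumes "S \<subseteq> idx"
  obtains "S = {}" | a where "S = {a}" | a b where "S = {a, b}" "a \<noteq> b"
    | a b c where "S = {a, b, c}" "distinct [a, b, c]"
    | a b c d where "S = {a, b, c, d}" "distinct [a, b, c, d]"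
proof -
  have fin: "finite S" using assms by (simp add: finite_subset idx_def)
  have "card S \<le> card idx" using assms by (intro card_mono) (simp_all add: idx_def)
  then have "card S \<le> 4" by (simp add: idx_def)
  obtain xs where xs: "set xs = S" "distinct xs" using fin finite_distinct_list by blast
  then have "length xs = 0 \<or> length xs = 1 \<or> length xs = 2 \<or> length xs = 3 \<or> length xs = 4"
    using \<open>card S \<le> 4\<close> distinct_card[OF xs(2)] unfolding xs(1) by linarith
  then show thesis using that xs by (auto simp: length_Suc_conv numeral_eq_Suc)
qed

lemma subset_idx_pair_cases:
  assumes "insert i (insert j T) \<subseteq> idx" "i \<noteq> j" "i \<notin> T" "j \<notin> T"
  obtains "T = {}" | l where "T = {l}" | l m where "T = {l, m}" "l \<noteq> m"
proof -
  have fin: "finite T" using finite_subset[OF assms(1)] by (simp add: idx_def)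
  have "card (insert i (insert j T)) \<le> card idx" using assms(1) by (intro card_mono) (simp_all add: idx_def)
  then have "card T \<le> 2" using fin assms(2-4) by (simp add: idx_def)
  then consider "card T = 0" | "card T = 1" | "card T = 2" by linarith
  then show thesis using that fin by cases (auto simp: card_1_singleton_iff card_2_iff)
qed

text \<open>Since there are only four indices, the common set \<open>T\<close> has at most two elements in Koteljanskii's
inequality and at most one in the triangle inequality.\<close>

lemma positive_definite_minor_like:
  assumes A: "positive_definite 4 A"
  shows "minor_like (principal_minor A)"
proof -
  let ?f = "entries A"
  note carrier = positive_definite_entries(1)[OF A] and pd = positive_definite_entries(2)[OF A]
  have pm: "principal_minor A S = re_det S ?f" if "S \<subseteq> idx" for S
    using principal_minor_eq_index_det[OF carrier that] .
  have sub: "herm_pd S ?f" if "S \<subseteq> idx" for S using herm_pd_subset[OF pd that] .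
  show ?thesis
    unfolding minor_like_def
  proof (intro conjI allI impI; (elim conjE)?)
    fix S assume S: "S \<subseteq> idx"
    then have "pos_real (index_det S ?f)"
    proof (cases rule: subset_idx_list_cases)
      case 1 then show ?thesis by (auto simp: index_det_0 pos_real_def intro: exI[of _ 1])
    next
      case 2 then show ?thesis using sub[OF S] herm_pd_pos_1 by (auto simp: index_det_1)
    next
      case 3 then show ?thesis using sub[OF S] herm_pd_pos_2 by auto
    next
      case 4 then show ?thesis using sub[OF S] herm_pd_pos_3 by auto
    next
      case 5 then show ?thesis using sub[OF S] herm_pd_pos_4 by auto
    qed
    then show "0 < principal_minor A S" using pos_realD pm[OF S] by auto
  next
    fix T i j assume T: "insert i (insert j T) \<subseteq> idx" "i \<noteq> j" "i \<notin> T" "j \<notin> T"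
    have eq: "principal_minor A (insert i (insert j T)) = re_det (insert i (insert j T)) ?f"
       "principal_minor A T = re_det T ?f" "principal_minor A (insert i T) = re_det (insert i T) ?f"
       "principal_minor A (insert j T) = re_det (insert j T) ?f"
      by (intro pm; use T in blast)+
    show "principal_minor A (insert i (insert j T)) * principal_minor A T
        \<le> principal_minor A (insert i T) * principal_minor A (insert j T)"
      using T(1-4) unfolding eq
    proof (cases rule: subset_idx_pair_cases)
      case 1
      then show "re_det (insert i (insert j T)) ?f * re_det T ?f \<le> re_det (insert i T) ?f * re_det (insert j T) ?f"
        using koteljanskii_0[OF sub, of i j] T by (simp add: index_det_0)
    next
      case (2 l)
      then show "re_det (insert i (insert j T)) ?f * re_det T ?f \<le> re_det (insert i T) ?f * re_det (insert j T) ?f"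
        using koteljanskii_1[OF sub, of l i j] T by (simp add: insert_commute)
    next
      case (3 l m)
      then show "re_det (insert i (insert j T)) ?f * re_det T ?f \<le> re_det (insert i T) ?f * re_det (insert j T) ?f"
        using koteljanskii_2[OF sub, of l m i j] T by (simp add: insert_commute)
    qed
  next
    fix T i j k assume T: "insert i (insert j (insert k T)) \<subseteq> idx" "distinct [i, j, k]" "{i, j, k} \<inter> T = {}"
    have "principal_minor A (insert j (insert k T)) = re_det (insert j (insert k T)) ?f"
      "principal_minor A (insert i (insert k T)) = re_det (insert i (insert k T)) ?f"
      "principal_minor A (insert i (insert j T)) = re_det (insert i (insert j T)) ?f"
      "principal_minor A (insert i T) = re_det (insert i T) ?f"
      "principal_minor A (insert j T) = re_det (insert j T) ?f"
      "principal_minor A (insert k T) = re_det (insert k T) ?f"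
      by (intro pm; use T in blast)+
    note eq = this
    have "T = {} \<or> (\<exists>l. T = {l})"
    proof -
      have fin: "finite T" using finite_subset[OF T(1)] by (simp add: idx_def)
      have "card (insert i (insert j (insert k T))) \<le> card idx"
        using T(1) by (intro card_mono) (simp_all add: idx_def)
      then have "card T \<le> 1" using fin T(2,3) by (simp add: idx_def)
      then have "card T = 0 \<or> card T = 1" by linarith
      then show ?thesis using fin by (auto simp: card_1_singleton_iff)
    qed
    then show "principal_minor A (insert j (insert k T)) * principal_minor A (insert i T)
       \<le> 2 * (principal_minor A (insert i (insert j T)) * principal_minor A (insert k T) +
              principal_minor A (insert i (insert k T)) * principal_minor A (insert j T))"
    proof (elim disjE exE)
      assume "T = {}"
      then show ?thesis unfolding eq using triangle_0[OF sub, of i j k] T by simp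
    next
      fix l assume "T = {l}"
      then show ?thesis unfolding eq using triangle_1[OF sub, of l i j k] T by (simp add: insert_commute)
    qed
  qed
qed

section \<open>Boundedness of the generators\<close>

text \<open>The triangle inequality for \<open>i, j, k\<close> over \<open>{l}\<close>, followed by those for \<open>i, k, l\<close> and \<open>i, j, l\<close> over the
empty set, bounds the left-hand side times \<open>d {i, l}\<close> by four products. Two of them are as desired. The
other two are, if \<open>d {i, j, k} * d {i, l}\<close> is the largest of the three ways to distribute \<open>j, k, l\<close>.\<close>

lemma minor_like_exchange_at_max:
  assumes d: "minor_like d" and ijkl: "idx = {i, j, k, l}" "distinct [i, j, k, l]"
    and max: "d {i, j, l} * d {i, k} \<le> d {i, j, k} * d {i, l}"
      "d {i, k, l} * d {i, j} \<le> d {i, j, k} * d {i, l}"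
  shows "d {i} * d {j, k, l} \<le> 8 * (d {i, j, k} * d {l} + d {i, j, l} * d {k} + d {i, k, l} * d {j})"
proof -
  have pos: "0 < d S" if "S \<subseteq> idx" for S by (rule minor_like_pos[OF d that])
  have p: "0 < d {i}" "0 < d {j}" "0 < d {k}" "0 < d {l}" "0 < d {i, l}" "0 < d {i, j, l}" "0 < d {i, k, l}"
    by (intro pos; use ijkl in blast)+
  have "d {j, k, l} * d {i, l} \<le> 2 * (d {i, j, l} * d {k, l} + d {i, k, l} * d {j, l})"
    using minor_like_triangle[OF d, of i j k "{l}"] ijkl by simp
  then have "d {i} * (d {j, k, l} * d {i, l}) \<le> d {i} * (2 * (d {i, j, l} * d {k, l} + d {i, k, l} * d {j, l}))"
    using p by (intro mult_left_mono) auto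
  also have "\<dots> = 2 * (d {i, j, l} * (d {k, l} * d {i}) + d {i, k, l} * (d {j, l} * d {i}))"
    by (simp add: algebra_simps)
  also have "\<dots> \<le> 2 * (d {i, j, l} * (2 * (d {i, k} * d {l} + d {i, l} * d {k}))
      + d {i, k, l} * (2 * (d {i, j} * d {l} + d {i, l} * d {j})))"
  proof -
    have "d {k, l} * d {i} \<le> 2 * (d {i, k} * d {l} + d {i, l} * d {k})"
      "d {j, l} * d {i} \<le> 2 * (d {i, j} * d {l} + d {i, l} * d {j})"
      using minor_like_triangle[OF d, of i k l "{}"] minor_like_triangle[OF d, of i j l "{}"] ijkl by auto
    then show ?thesis using p by (intro mult_left_mono add_mono) auto
  qed
  also have "\<dots> = 4 * ((d {i, j, l} * d {i, k}) * d {l} + (d {i, k, l} * d {i, j}) * d {l}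
      + d {i, l} * (d {i, j, l} * d {k} + d {i, k, l} * d {j}))"
    by (simp add: algebra_simps)
  also have "\<dots> \<le> 4 * ((d {i, j, k} * d {i, l}) * d {l} + (d {i, j, k} * d {i, l}) * d {l}
      + d {i, l} * (d {i, j, l} * d {k} + d {i, k, l} * d {j}))"
    using p max by (intro mult_left_mono add_mono mult_right_mono) auto
  also have "\<dots> \<le> d {i, l} * (8 * (d {i, j, k} * d {l} + d {i, j, l} * d {k} + d {i, k, l} * d {j}))"
    using p by (simp add: algebra_simps)
  finally show ?thesis using p by (simp add: mult.commute[of "d {i, l}"] flip: mult.assoc)
qed

text \<open>A multiplicative exchange property: up to a constant, \<open>d {1} * d {2, 3, 4}\<close> does not exceed the
sum of the products obtained by moving two elements from the larger set to the smaller one. One of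
the three distributions is the largest, whence \<open>minor_like_exchange_at_max\<close> applies.\<close>

lemma minor_like_exchange:
  assumes d: "minor_like d"
  shows "d {1} * d {2, 3, 4} \<le> 8 * (d {1, 2, 3} * d {4} + d {1, 2, 4} * d {3} + d {1, 3, 4} * d {2})"
proof -
  let ?x = "d {1, 2, 3} * d {1, 4}" and ?y = "d {1, 2, 4} * d {1, 3}" and ?z = "d {1, 3, 4} * d {1, 2}"
  consider "?y \<le> ?x" "?z \<le> ?x" | "?x \<le> ?y" "?z \<le> ?y" | "?x \<le> ?z" "?y \<le> ?z" by linarith
  then show ?thesis
  proof cases
    case 1
    then show ?thesis using minor_like_exchange_at_max[OF d, of 1 2 3 4] by (auto simp: idx_def)
  next
    case 2
    have "idx = {1, 2, 4, 3}" by (auto simp: idx_def)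
    then show ?thesis using 2 minor_like_exchange_at_max[OF d, of 1 2 4 3]
      by (simp add: insert_commute[of 4 3])
  next
    case 3
    have "idx = {1, 3, 4, 2}" by (auto simp: idx_def)
    moreover have "{3, 4, 2} = {2, 3, 4::nat}" "{1, 3, 2} = {1, 2, 3::nat}" "{1, 4, 2} = {1, 2, 4::nat}" by auto
    ultimately show ?thesis using 3 minor_like_exchange_at_max[OF d, of 1 3 4 2] by simp
  qed
qed

text \<open>The submodular inequality for the sets \<open>{i, j}\<close> and \<open>{j, k, l}\<close>, obtained by adding \<open>k\<close> and \<open>l\<close> one
at a time.\<close>

lemma minor_like_koteljanskii_chain:
  assumes d: "minor_like d" and ijkl: "{i, j, k, l} \<subseteq> idx" "distinct [i, j, k, l]"
  shows "d {i, j, k, l} * d {j} \<le> d {i, j} * d {j, k, l}"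
proof -
  have p: "0 < d {i, j, k}" "0 < d {j, k}" "0 < d {j, k, l}" "0 < d {j}"
    by (intro minor_like_pos[OF d]; use ijkl in blast)+
  have 1: "d {i, j, k, l} * d {j, k} \<le> d {i, j, k} * d {j, k, l}"
    using minor_like_koteljanskii[OF d, of i l "{j, k}"] ijkl by (simp add: insert_commute)
  have 2: "d {i, j, k} * d {j} \<le> d {i, j} * d {j, k}"
    using minor_like_koteljanskii[OF d, of i k "{j}"] ijkl by (simp add: insert_commute)
  have "(d {i, j, k, l} * d {j}) * d {j, k} = (d {i, j, k, l} * d {j, k}) * d {j}" by simp
  also have "\<dots> \<le> (d {i, j, k} * d {j, k, l}) * d {j}" using 1 p by (intro mult_right_mono) auto
  also have "\<dots> = (d {i, j, k} * d {j}) * d {j, k, l}" by simp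
  also have "\<dots> \<le> (d {i, j} * d {j, k}) * d {j, k, l}" using 2 p by (intro mult_right_mono) auto
  also have "\<dots> = (d {i, j} * d {j, k, l}) * d {j, k}" by simp
  finally show ?thesis using p by simp
qed

text \<open>The triangle inequality for \<open>d {2,3} * d {1}\<close> leaves two terms, each of which is a product of two
instances of Koteljanskii's inequality.\<close>

lemma minor_like_R1:
  assumes d: "minor_like d"
  shows "d {1,2,4} * d {1,3,4} * d {2,3} * d {1} * d {4} \<le>
    4 * (d {1,2} * d {1,3} * d {1,4} * d {2,4} * d {3,4})"
proof -
  have p: "0 < d {1,2}" "0 < d {1,3}" "0 < d {1,4}" "0 < d {2,4}" "0 < d {3,4}" "0 < d {4}" "0 < d {3}" "0 < d {2}"
    "0 < d {1,2,4}" "0 < d {1,3,4}"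
    by (intro minor_like_pos[OF d]; simp add: idx_def)+
  have t: "d {2,3} * d {1} \<le> 2 * (d {1,2} * d {3} + d {1,3} * d {2})"
    using minor_like_triangle[OF d, of 1 2 3 "{}"] by (simp add: idx_def)
  have k: "d {1,2,4} * d {4} \<le> d {1,4} * d {2,4}" "d {1,3,4} * d {3} \<le> d {1,3} * d {3,4}"
      "d {1,2,4} * d {2} \<le> d {1,2} * d {2,4}" "d {1,3,4} * d {4} \<le> d {1,4} * d {3,4}"
    using minor_like_koteljanskii[OF d, of 1 2 "{4}"] minor_like_koteljanskii[OF d, of 1 4 "{3}"]
      minor_like_koteljanskii[OF d, of 1 4 "{2}"] minor_like_koteljanskii[OF d, of 1 3 "{4}"]
    by (simp_all add: idx_def insert_commute)
  have "d {1,2,4} * d {1,3,4} * d {2,3} * d {1} * d {4} = (d {1,2,4} * d {1,3,4} * d {4}) * (d {2,3} * d {1})"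
    by (simp add: mult_ac)
  also have "\<dots> \<le> (d {1,2,4} * d {1,3,4} * d {4}) * (2 * (d {1,2} * d {3} + d {1,3} * d {2}))"
    using t p by (intro mult_left_mono) auto
  also have "\<dots> = 2 * (d {1,2} * ((d {1,2,4} * d {4}) * (d {1,3,4} * d {3})) + d {1,3} * ((d {1,2,4} * d {2}) * (d {1,3,4} * d {4})))"
    by (simp add: algebra_simps)
  also have "\<dots> \<le> 2 * (d {1,2} * ((d {1,4} * d {2,4}) * (d {1,3} * d {3,4})) + d {1,3} * ((d {1,2} * d {2,4}) * (d {1,4} * d {3,4})))"
  proof -
    have "(d {1,2,4} * d {4}) * (d {1,3,4} * d {3}) \<le> (d {1,4} * d {2,4}) * (d {1,3} * d {3,4})"
      by (rule mult_mono[OF k(1,2)]) (use p in auto)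
    moreover have "(d {1,2,4} * d {2}) * (d {1,3,4} * d {4}) \<le> (d {1,2} * d {2,4}) * (d {1,4} * d {3,4})"
      by (rule mult_mono[OF k(3,4)]) (use p in auto)
    ultimately show ?thesis using p by (intro mult_left_mono add_mono) auto
  qed
  also have "\<dots> = 4 * (d {1,2} * d {1,3} * d {1,4} * d {2,4} * d {3,4})" by (simp add: mult_ac)
  finally show ?thesis .
qed

text \<open>Multiplied by \<open>d {2,3,4}\<close>, the left-hand side contains \<open>d {1} * d {2,3,4}\<close>. The exchange property
replaces it by three terms that Koteljanskii's inequality estimates factor by factor.\<close>

lemma minor_like_R2:
  assumes d: "minor_like d"
  shows "d {1,2,3,4} * d {1,2,3,4} * d {2,3} * d {2,4} * d {3,4} * d {1} * d {} \<le>
    24 * (d {1,2,3} * d {1,2,4} * d {1,3,4} * d {2,3,4} * d {2} * d {3} * d {4})"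
    (is "?L \<le> 24 * ?R")
proof -
  let ?D = "d {1,2,3,4}" and ?e = "d {2,3,4}"
  have p: "0 < d {1,2,3}" "0 < d {1,2,4}" "0 < d {1,3,4}" "0 < ?e" "0 < d {2}" "0 < d {3}" "0 < d {4}" "0 < d {}"
    "0 < ?D" "0 < d {2,3}" "0 < d {2,4}" "0 < d {3,4}"
    by (intro minor_like_pos[OF d]; simp add: idx_def)+
  have k: "?D * d {2,3} \<le> d {1,2,3} * ?e" "?D * d {2,4} \<le> d {1,2,4} * ?e" "?D * d {3,4} \<le> d {1,3,4} * ?e"
    "d {2,3} * d {} \<le> d {2} * d {3}" "d {2,4} * d {} \<le> d {2} * d {4}" "d {3,4} * d {} \<le> d {3} * d {4}"
    using minor_like_koteljanskii[OF d, of 1 4 "{2,3}"] minor_like_koteljanskii[OF d, of 1 3 "{2,4}"]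
      minor_like_koteljanskii[OF d, of 1 2 "{3,4}"] minor_like_koteljanskii[OF d, of 2 3 "{}"]
      minor_like_koteljanskii[OF d, of 2 4 "{}"] minor_like_koteljanskii[OF d, of 3 4 "{}"]
    by (simp_all add: idx_def insert_commute)
  have "?L * ?e = (?D * ?D * d {2,3} * d {2,4} * d {3,4} * d {}) * (d {1} * ?e)" by (simp add: mult_ac)
  also have "\<dots> \<le> (?D * ?D * d {2,3} * d {2,4} * d {3,4} * d {}) *
      (8 * (d {1,2,3} * d {4} + d {1,2,4} * d {3} + d {1,3,4} * d {2}))"
    using p minor_like_exchange[OF d] by (intro mult_left_mono) auto
  also have "\<dots> = 8 * ((?D * d {2,4}) * (?D * d {3,4}) * (d {2,3} * d {}) * (d {1,2,3} * d {4})
     + (?D * d {2,3}) * (?D * d {3,4}) * (d {2,4} * d {}) * (d {1,2,4} * d {3})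
     + (?D * d {2,3}) * (?D * d {2,4}) * (d {3,4} * d {}) * (d {1,3,4} * d {2}))"
    by (simp add: algebra_simps)
  also have "\<dots> \<le> 8 * ((d {1,2,4} * ?e) * (d {1,3,4} * ?e) * (d {2} * d {3}) * (d {1,2,3} * d {4})
     + (d {1,2,3} * ?e) * (d {1,3,4} * ?e) * (d {2} * d {4}) * (d {1,2,4} * d {3})
     + (d {1,2,3} * ?e) * (d {1,2,4} * ?e) * (d {3} * d {4}) * (d {1,3,4} * d {2}))"
  proof -
    have "(?D * d {2,4}) * (?D * d {3,4}) * (d {2,3} * d {}) \<le> (d {1,2,4} * ?e) * (d {1,3,4} * ?e) * (d {2} * d {3})"
      "(?D * d {2,3}) * (?D * d {3,4}) * (d {2,4} * d {}) \<le> (d {1,2,3} * ?e) * (d {1,3,4} * ?e) * (d {2} * d {4})"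
      "(?D * d {2,3}) * (?D * d {2,4}) * (d {3,4} * d {}) \<le> (d {1,2,3} * ?e) * (d {1,2,4} * ?e) * (d {3} * d {4})"
      by (rule mult_mono[OF mult_mono[OF k(2,3)] k(4)] mult_mono[OF mult_mono[OF k(1,3)] k(5)]
          mult_mono[OF mult_mono[OF k(1,2)] k(6)]; use p in auto)+
    then show ?thesis using p by (intro mult_left_mono add_mono mult_right_mono) auto
  qed
  also have "\<dots> = 24 * ?R * ?e" by (simp add: mult_ac)
  finally show ?thesis by (rule mult_right_le_imp_le) (rule p(4))
qed

text \<open>Two triangle inequalities produce four terms. All but the one with \<open>d {1,2}\<close> squared are products
of Koteljanskii inequalities; in that one, \<open>d {1,2}\<close> is first traded for \<open>d {1} * d {2}\<close>, and the freed
\<open>d {1}\<close> is spent on a third triangle inequality.\<close>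

lemma minor_like_R3:
  assumes d: "minor_like d"
  shows "d {1,2,3,4} * d {2,3} * d {2,4} * d {3,4} * d {1} * d {1} * d {} \<le>
    28 * (d {2,3,4} * d {1,2} * d {1,3} * d {1,4} * d {2} * d {3} * d {4})"
    (is "?L \<le> 28 * ?R")
proof -
  let ?D = "d {1,2,3,4}" and ?e = "d {2,3,4}"
  have p: "0 < d {1,2}" "0 < d {1,3}" "0 < d {1,4}" "0 < ?e" "0 < d {2}" "0 < d {3}" "0 < d {4}" "0 < d {}"
    "0 < ?D" "0 < d {2,3}" "0 < d {2,4}" "0 < d {3,4}" "0 < d {1}"
    by (intro minor_like_pos[OF d]; simp add: idx_def)+
  have t: "d {2,3} * d {1} \<le> 2 * (d {1,2} * d {3} + d {1,3} * d {2})"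
    "d {2,4} * d {1} \<le> 2 * (d {1,2} * d {4} + d {1,4} * d {2})"
    "d {3,4} * d {1} \<le> 2 * (d {1,3} * d {4} + d {1,4} * d {3})"
    using minor_like_triangle[OF d, of 1 2 3 "{}"] minor_like_triangle[OF d, of 1 2 4 "{}"]
      minor_like_triangle[OF d, of 1 3 4 "{}"] by (simp_all add: idx_def)
  have k: "?D * d {2} \<le> d {1,2} * ?e" "?D * d {3} \<le> d {1,3} * ?e" "?D * d {4} \<le> d {1,4} * ?e"
    "d {3,4} * d {} \<le> d {3} * d {4}" "d {1,2} * d {} \<le> d {1} * d {2}"
    using minor_like_koteljanskii_chain[OF d, of 1 2 3 4] minor_like_koteljanskii_chain[OF d, of 1 3 2 4]
      minor_like_koteljanskii_chain[OF d, of 1 4 2 3] minor_like_koteljanskii[OF d, of 3 4 "{}"]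
      minor_like_koteljanskii[OF d, of 1 2 "{}"]
    by (simp_all add: idx_def insert_commute)
  have s: "d {1,2} * d {1,2} * d {3} * d {4} * d {3,4} * ?D * d {} \<le> 4 * ?R"
  proof -
    have "d {1,2} * d {1,2} * d {3} * d {4} * d {3,4} * ?D * d {} =
        (d {1,2} * d {}) * (d {1,2} * d {3} * d {4} * d {3,4} * ?D)" by (simp add: mult_ac)
    also have "\<dots> \<le> (d {1} * d {2}) * (d {1,2} * d {3} * d {4} * d {3,4} * ?D)"
      using p k by (intro mult_right_mono) auto
    also have "\<dots> = (d {2} * d {1,2} * d {3} * d {4} * ?D) * (d {3,4} * d {1})" by (simp add: mult_ac)
    also have "\<dots> \<le> (d {2} * d {1,2} * d {3} * d {4} * ?D) * (2 * (d {1,3} * d {4} + d {1,4} * d {3}))"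
      using p t by (intro mult_left_mono) auto
    also have "\<dots> = 2 * (d {2} * d {1,2} * d {3} * d {4}) * ((?D * d {4}) * d {1,3} + (?D * d {3}) * d {1,4})"
      by (simp add: algebra_simps)
    also have "\<dots> \<le> 2 * (d {2} * d {1,2} * d {3} * d {4}) * ((d {1,4} * ?e) * d {1,3} + (d {1,3} * ?e) * d {1,4})"
      using p k by (intro mult_left_mono add_mono mult_right_mono) auto
    also have "\<dots> = 4 * ?R" by (simp add: algebra_simps)
    finally show ?thesis .
  qed
  have "?L = (?D * d {3,4} * d {}) * ((d {2,3} * d {1}) * (d {2,4} * d {1}))" by (simp add: mult_ac)
  also have "\<dots> \<le> (?D * d {3,4} * d {}) * ((2 * (d {1,2} * d {3} + d {1,3} * d {2})) * (2 * (d {1,2} * d {4} + d {1,4} * d {2})))"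
    by (rule mult_left_mono[OF mult_mono[OF t(1,2)]]) (use p in auto)
  also have "\<dots> = 4 * (d {1,2} * d {1,2} * d {3} * d {4} * d {3,4} * ?D * d {}
      + (d {3,4} * d {}) * (?D * d {3}) * (d {1,2} * d {1,4} * d {2})
      + (d {3,4} * d {}) * (?D * d {4}) * (d {1,2} * d {1,3} * d {2})
      + (d {3,4} * d {}) * (?D * d {2}) * (d {1,3} * d {1,4} * d {2}))"
    by (simp add: algebra_simps)
  also have "\<dots> \<le> 4 * (4 * ?R
      + (d {3} * d {4}) * (d {1,3} * ?e) * (d {1,2} * d {1,4} * d {2})
      + (d {3} * d {4}) * (d {1,4} * ?e) * (d {1,2} * d {1,3} * d {2})
      + (d {3} * d {4}) * (d {1,2} * ?e) * (d {1,3} * d {1,4} * d {2}))"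
  proof -
    have "(d {3,4} * d {}) * (?D * d {3}) \<le> (d {3} * d {4}) * (d {1,3} * ?e)"
      "(d {3,4} * d {}) * (?D * d {4}) \<le> (d {3} * d {4}) * (d {1,4} * ?e)"
      "(d {3,4} * d {}) * (?D * d {2}) \<le> (d {3} * d {4}) * (d {1,2} * ?e)"
      by (rule mult_mono[OF k(4,2)] mult_mono[OF k(4,3)] mult_mono[OF k(4,1)]; use p in auto)+
    then show ?thesis using p s by (intro mult_left_mono add_mono mult_right_mono) auto
  qed
  also have "\<dots> = 28 * ?R" by (simp add: algebra_simps)
  finally show ?thesis .
qed

text \<open>The constant 28 is the largest of the constants for the five ratios.\<close>

lemma bounded_on_minor_like:
  assumes "r \<in> basic_ratios"
  obtains num den where "r = plain_ratio num den" "set num \<subseteq> Pow idx" "set den \<subseteq> Pow idx"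
    "\<And>d. minor_like d \<Longrightarrow> prod_list (map d num) \<le> 28 * prod_list (map d den)"
proof -
  note pos = minor_like_pos
  have k: "prod_list (map d [{1,2}, {}]) \<le> 28 * prod_list (map d [{1},{2}])"
      "prod_list (map d [{1,2,3}, {1}]) \<le> 28 * prod_list (map d [{1,2},{1,3}])" if d: "minor_like d" for d
  proof -
    have "0 < d {1} * d {2}" "0 < d {1,2} * d {1,3}"
      by (intro mult_pos_pos pos[OF d]; simp add: idx_def)+
    moreover have "d {1,2} * d {} \<le> d {1} * d {2}" "d {1,2,3} * d {1} \<le> d {1,2} * d {1,3}"
      using minor_like_koteljanskii[OF d, of 1 2 "{}"] minor_like_koteljanskii[OF d, of 2 3 "{1}"]
      by (simp_all add: idx_def insert_commute)
    ultimately show "prod_list (map d [{1,2}, {}]) \<le> 28 * prod_list (map d [{1},{2}])"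
      "prod_list (map d [{1,2,3}, {1}]) \<le> 28 * prod_list (map d [{1,2},{1,3}])" by simp_all
  qed
  have R: "prod_list (map d [{1,2,4}, {1,3,4}, {2,3}, {1}, {4}]) \<le> 28 * prod_list (map d [{1,2}, {1,3}, {1,4}, {2,4}, {3,4}])"
     "prod_list (map d [{1,2,3,4}, {1,2,3,4}, {2,3}, {2,4}, {3,4}, {1}, {}]) \<le>
        28 * prod_list (map d [{1,2,3}, {1,2,4}, {1,3,4}, {2,3,4}, {2}, {3}, {4}])"
     "prod_list (map d [{1,2,3,4}, {2,3}, {2,4}, {3,4}, {1}, {1}, {}]) \<le>
        28 * prod_list (map d [{2,3,4}, {1,2}, {1,3}, {1,4}, {2}, {3}, {4}])"
    if d: "minor_like d" for d
  proof -
    have "0 < d {1,2} * d {1,3} * d {1,4} * d {2,4} * d {3,4}"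
      "0 < d {1,2,3} * d {1,2,4} * d {1,3,4} * d {2,3,4} * d {2} * d {3} * d {4}"
      by (intro mult_pos_pos pos[OF d]; simp add: idx_def)+
    with minor_like_R1[OF d] minor_like_R2[OF d] minor_like_R3[OF d]
    show "prod_list (map d [{1,2,4}, {1,3,4}, {2,3}, {1}, {4}]) \<le> 28 * prod_list (map d [{1,2}, {1,3}, {1,4}, {2,4}, {3,4}])"
     "prod_list (map d [{1,2,3,4}, {1,2,3,4}, {2,3}, {2,4}, {3,4}, {1}, {}]) \<le>
        28 * prod_list (map d [{1,2,3}, {1,2,4}, {1,3,4}, {2,3,4}, {2}, {3}, {4}])"
     "prod_list (map d [{1,2,3,4}, {2,3}, {2,4}, {3,4}, {1}, {1}, {}]) \<le>
        28 * prod_list (map d [{2,3,4}, {1,2}, {1,3}, {1,4}, {2}, {3}, {4}])"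
      by (simp_all add: mult.assoc)
  qed
  show thesis
    using assms unfolding basic_ratios_def
  proof (elim insertE emptyE, goal_cases)
    case 1
    show ?case by (rule that[OF 1 _ _ k(1)]) (simp_all add: idx_def)
  next
    case 2
    show ?case by (rule that[OF 2 _ _ k(2)]) (simp_all add: idx_def)
  next
    case 3
    show ?case by (rule that[OF 3 _ _ R(1)]) (simp_all add: idx_def)
  next
    case 4
    show ?case by (rule that[OF 4 _ _ R(2)]) (simp_all add: idx_def)
  next
    case 5
    show ?case by (rule that[OF 5 _ _ R(3)]) (simp_all add: idx_def)
  qed
qed

lemma prod_list_pos:
  "(\<And>x. x \<in> set xs \<Longrightarrow> 0 < x) \<Longrightarrow> 0 < prod_list (xs :: real list)"
  by (induction xs) auto

lemma index_symmetries_subset: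
  assumes "f \<in> index_symmetries" "S \<subseteq> idx"
  shows "f S \<subseteq> idx"
  using assms permutes_image by (fastforce simp: index_symmetries_def)

lemma eval_product_plain:
  assumes A: "positive_definite 4 A" and "set Ss \<subseteq> Pow idx"
  shows "eval_product (map (\<lambda>S. (S, 1)) Ss) A = prod_list (map (principal_minor A) Ss)"
  using assms(2)
proof (induction Ss)
  case (Cons S Ss)
  then have "0 < principal_minor A S"
    using minor_like_pos[OF positive_definite_minor_like[OF A]] by simp
  then show ?case using Cons by (simp add: eval_product_def)
qed (simp add: eval_product_def)

lemma generators4_cases:
  assumes "g \<in> generators4"
  obtains num den where "g = plain_ratio num den" "set num \<subseteq> Pow idx" "set den \<subseteq> Pow idx" "bounded_ratio g"
proof -
  obtain f r where g: "g = reindex f r" and f: "f \<in> index_symmetries" and r: "r \<in> basic_ratios"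
    using assms by (auto simp: generators4_def)
  obtain num den where nd: "r = plain_ratio num den" "set num \<subseteq> Pow idx" "set den \<subseteq> Pow idx"
    and bound: "\<And>d. minor_like d \<Longrightarrow> prod_list (map d num) \<le> 28 * prod_list (map d den)"
    using bounded_on_minor_like[OF r] by blast
  have g': "g = plain_ratio (map f num) (map f den)"
    by (simp add: g nd reindex_def plain_ratio_def)
  have sub: "set (map f xs) \<subseteq> Pow idx" if "set xs \<subseteq> Pow idx" for xs
    using that index_symmetries_subset[OF f] by (induction xs) auto
  note sub = sub[OF nd(2)] sub[OF nd(3)]
  have "eval_ratio g A \<le> 28" if A: "positive_definite 4 A" for A
  proof -
    have d: "minor_like (principal_minor A)" by (rule positive_definite_minor_like[OF A])
    have "prod_list (map (principal_minor A) (map f num)) \<le> 28 * prod_list (map (principal_minor A) (map f den))"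
      using bound[OF minor_like_symmetry[OF d f]] by (simp add: o_def)
    moreover have "0 < prod_list (map (principal_minor A) (map f den))"
      using sub minor_like_pos[OF d] by (intro prod_list_pos) auto
    ultimately show ?thesis
      unfolding g' eval_ratio_def plain_ratio_def fst_conv snd_conv
        eval_product_plain[OF A sub(1)] eval_product_plain[OF A sub(2)]
      by (simp add: divide_le_eq)
  qed
  then have "bounded_ratio g" unfolding bounded_ratio_def by blast
  then show thesis using that g' sub by blast
qed

section \<open>Ratios in logarithmic coordinates\<close>

lemma eval_product_append: "eval_product (\<alpha> @ \<beta>) A = eval_product \<alpha> A * eval_product \<beta> A"
  by (simp add: eval_product_def)

lemma eval_product_Cons: "eval_product ((S, \<eta>) # \<alpha>) A = principal_minor A S powr \<eta> * eval_product \<alpha> A"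
  by (simp add: eval_product_def)

lemma eval_product_nonneg: "0 \<le> eval_product \<alpha> A"
  by (induction \<alpha>) (auto simp: eval_product_def)

lemma eval_product_power:
  "eval_product (map (\<lambda>(S, \<eta>). (S, t * \<eta>)) \<alpha>) A = eval_product \<alpha> A powr t"
proof (induction \<alpha>)
  case (Cons p \<alpha>)
  then show ?case
    using eval_product_nonneg[of \<alpha> A] by (cases p) (simp add: eval_product_def powr_mult powr_powr mult.commute)
qed (simp add: eval_product_def)

lemma bounded_ratio_mult_power:
  assumes "bounded_ratio g" "bounded_ratio r" "t > 0"
  shows "bounded_ratio (ratio_mult (ratio_power g t) r)"
proof -
  obtain C D where C: "\<And>A. positive_definite 4 A \<Longrightarrow> eval_ratio g A \<le> C"
    and D: "\<And>A. positive_definite 4 A \<Longrightarrow> eval_ratio r A \<le> D"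
    using assms by (auto simp: bounded_ratio_def)
  have nonneg: "0 \<le> eval_ratio h A" for h A by (simp add: eval_ratio_def eval_product_nonneg)
  have "eval_ratio (ratio_mult (ratio_power g t) r) A \<le> C powr t * D" if A: "positive_definite 4 A" for A
  proof -
    have "eval_ratio (ratio_mult (ratio_power g t) r) A = eval_ratio g A powr t * eval_ratio r A"
      by (simp add: eval_ratio_def ratio_mult_def ratio_power_def eval_product_append
          eval_product_power powr_divide eval_product_nonneg)
    also have "\<dots> \<le> C powr t * D"
      using C[OF A] D[OF A] nonneg[of g A] nonneg[of r A] assms(3)
      by (intro mult_mono powr_mono2) auto
    finally show ?thesis .
  qed
  then show ?thesis unfolding bounded_ratio_def by blast
qed

lemma minor_products_append:
  "\<alpha> @ \<beta> \<in> minor_products \<longleftrightarrow> \<alpha> \<in> minor_products \<and> \<beta> \<in> minor_products"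
  by (auto simp: minor_products_def)

lemma minor_products_plain_power:
  "set Ss \<subseteq> Pow idx \<Longrightarrow> t > 0 \<Longrightarrow> map (\<lambda>(S, \<eta>). (S, t * \<eta>)) (map (\<lambda>S. (S, 1)) Ss) \<in> minor_products"
  by (auto simp: minor_products_def)

lemma power_products_bounded:
  assumes "r \<in> power_products generators4"
  shows "r \<in> minor_products \<times> minor_products \<and> bounded_ratio r"
  using assms
proof induction
  case one
  then show ?case
    by (auto simp: minor_products_def bounded_ratio_def eval_ratio_def eval_product_def)
next
  case (mult g t r)
  obtain num den where g: "g = plain_ratio num den" "set num \<subseteq> Pow idx" "set den \<subseteq> Pow idx" "bounded_ratio g"
    using generators4_cases[OF mult(1)] by blast
  have "ratio_mult (ratio_power g t) r \<in> minor_products \<times> minor_products"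
    using mult.IH mult.hyps(2) minor_products_plain_power[OF g(2)] minor_products_plain_power[OF g(3)]
    unfolding g(1) ratio_mult_def ratio_power_def plain_ratio_def fst_conv snd_conv
    by (simp add: minor_products_append mem_Times_iff)
  then show ?case using bounded_ratio_mult_power g(4) mult by blast
qed

lemma product_exponent_Cons:
  "product_exponent ((T, \<eta>) # \<alpha>) S = (if T = S then \<eta> else 0) + product_exponent \<alpha> S"
  by (simp add: product_exponent_def)

lemma eval_product_pos:
  assumes "\<And>S. S \<subseteq> idx \<Longrightarrow> 0 < principal_minor A S" "\<alpha> \<in> minor_products"
  shows "0 < eval_product \<alpha> A"
  using assms(2)
proof (induction \<alpha>)
  case (Cons p \<alpha>)
  then have "0 < eval_product \<alpha> A" "0 < principal_minor A (fst p)"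
    using assms(1) by (auto simp: minor_products_def)
  then show ?case by (auto simp: eval_product_def split: prod.splits)
qed (simp add: eval_product_def)

lemma ln_eval_product:
  assumes pos: "\<And>S. S \<subseteq> idx \<Longrightarrow> 0 < principal_minor A S" and \<alpha>: "\<alpha> \<in> minor_products"
  shows "ln (eval_product \<alpha> A) = (\<Sum>S\<in>Pow idx. product_exponent \<alpha> S * ln (principal_minor A S))"
  using \<alpha>
proof (induction \<alpha>)
  case (Cons p \<alpha>)
  obtain T \<eta> where p: "p = (T, \<eta>)" by (cases p)
  have T: "T \<subseteq> idx" and \<alpha>: "\<alpha> \<in> minor_products" using Cons.prems by (auto simp: minor_products_def p)
  have "ln (eval_product (p # \<alpha>) A) = \<eta> * ln (principal_minor A T) + ln (eval_product \<alpha> A)"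
    using pos[OF T] eval_product_pos[OF pos \<alpha>] by (simp add: p eval_product_Cons ln_mult ln_powr)
  also have "\<eta> * ln (principal_minor A T) =
      (\<Sum>S\<in>Pow idx. (if T = S then \<eta> else 0) * ln (principal_minor A S))"
    using T by (simp add: if_distrib[of "\<lambda>c. c * _"] sum.delta' idx_def cong: if_cong)
  finally show ?case
    by (simp add: p product_exponent_Cons Cons.IH[OF \<alpha>] distrib_right sum.distrib)
qed (simp add: eval_product_def product_exponent_def)

text \<open>The normalised exponent of the empty set may stand in this formula because it is multiplied by the
logarithm of 1.\<close>

lemma ln_eval_ratio:
  assumes A: "positive_definite 4 A" and r: "r \<in> minor_products \<times> minor_products"
  shows "ln (eval_ratio r A) = (\<Sum>S\<in>Pow idx. ratio_class r S * ln (principal_minor A S))"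
proof -
  have pos: "\<And>S. S \<subseteq> idx \<Longrightarrow> 0 < principal_minor A S"
    by (rule minor_like_pos[OF positive_definite_minor_like[OF A]])
  have r': "fst r \<in> minor_products" "snd r \<in> minor_products" using r by auto
  have "principal_minor A {} = 1"
    using principal_minor_eq_index_det[OF positive_definite_entries(1)[OF A], of "{}"]
    by (simp add: index_det_0)
  then have "ratio_class r S * ln (principal_minor A S) = overall_exponent r S * ln (principal_minor A S)" for S
    by (simp add: ratio_class_def)
  then show ?thesis
    using eval_product_pos[OF pos r'(1)] eval_product_pos[OF pos r'(2)]
      ln_eval_product[OF pos r'(1)] ln_eval_product[OF pos r'(2)]
    by (simp add: eval_ratio_def ln_div overall_exponent_def left_diff_distrib sum_subtractf)
qed

text \<open>A direction \<open>w\<close> in which the logarithms of the minors of positive definite matrices can tend to infinity,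
up to a bounded error.\<close>

definition growth_rate :: "(nat set \<Rightarrow> real) \<Rightarrow> bool" where
  "growth_rate w \<longleftrightarrow> (\<exists>c C. 0 < c \<and> (\<forall>t\<ge>1. \<exists>A. positive_definite 4 A \<and>
     (\<forall>S\<subseteq>idx. c * t powr w S \<le> principal_minor A S \<and> principal_minor A S \<le> C * t powr w S)))"

lemma growth_rateI:
  assumes "0 < c" "\<And>t. 1 \<le> t \<Longrightarrow> positive_definite 4 (A t)"
    and "\<And>t S. 1 \<le> t \<Longrightarrow> S \<subseteq> idx \<Longrightarrow>
      c * t powr w S \<le> principal_minor (A t) S \<and> principal_minor (A t) S \<le> C * t powr w S"
  shows "growth_rate w"
  unfolding growth_rate_def using assms by blast

text \<open>Along the family, the logarithm of the ratio is the sum in question times \<open>ln t\<close>, up to a bounded error.\<close>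

lemma bounded_ratio_growth:
  assumes r: "r \<in> minor_products \<times> minor_products" "bounded_ratio r" and w: "growth_rate w"
  shows "(\<Sum>S\<in>Pow idx. ratio_class r S * w S) \<le> 0"
proof (rule ccontr)
  define \<gamma> where "\<gamma> = (\<Sum>S\<in>Pow idx. ratio_class r S * w S)"
  assume "\<not> (\<Sum>S\<in>Pow idx. ratio_class r S * w S) \<le> 0"
  then have \<gamma>: "\<gamma> > 0" by (simp add: \<gamma>_def)
  obtain c C where c: "0 < c" and fam: "\<And>t. t \<ge> 1 \<Longrightarrow> \<exists>A. positive_definite 4 A \<and>
     (\<forall>S\<subseteq>idx. c * t powr w S \<le> principal_minor A S \<and> principal_minor A S \<le> C * t powr w S)"
    using w by (auto simp: growth_rate_def)
  obtain M where M: "\<And>A. positive_definite 4 A \<Longrightarrow> eval_ratio r A \<le> M"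
    using r(2) by (auto simp: bounded_ratio_def)
  define B where "B = (\<Sum>S\<in>Pow idx. \<bar>ratio_class r S\<bar> * (\<bar>ln c\<bar> + \<bar>ln C\<bar>))"
  have upper: "\<gamma> * ln t \<le> ln M + B" if t: "t \<ge> 1" for t
  proof -
    obtain A where A: "positive_definite 4 A"
      and lo: "\<And>S. S \<subseteq> idx \<Longrightarrow> c * t powr w S \<le> principal_minor A S"
      and hi: "\<And>S. S \<subseteq> idx \<Longrightarrow> principal_minor A S \<le> C * t powr w S"
      using fam[OF t] by blast
    have pos: "\<And>S. S \<subseteq> idx \<Longrightarrow> 0 < principal_minor A S"
      by (rule minor_like_pos[OF positive_definite_minor_like[OF A]])
    have dev: "\<bar>ln (principal_minor A S) - w S * ln t\<bar> \<le> \<bar>ln c\<bar> + \<bar>ln C\<bar>" if S: "S \<subseteq> idx" for S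
    proof -
      have tp: "0 < t powr w S" using t by simp
      have C: "0 < C" using pos[OF S] hi[OF S] tp by (metis less_le_trans zero_less_mult_pos2)
      have "ln (c * t powr w S) \<le> ln (principal_minor A S)"
        using lo[OF S] c tp by (intro ln_mono) auto
      moreover have "ln (principal_minor A S) \<le> ln (C * t powr w S)"
        using hi[OF S] pos[OF S] C tp by (intro ln_mono) auto
      ultimately show ?thesis using c C t by (simp add: ln_mult ln_powr)
    qed
    have eval_pos: "0 < eval_ratio r A"
      using eval_product_pos[OF pos, of "fst r"] eval_product_pos[OF pos, of "snd r"] r(1)
      by (auto simp: eval_ratio_def)
    have "\<gamma> * ln t - ln (eval_ratio r A) =
        (\<Sum>S\<in>Pow idx. ratio_class r S * (w S * ln t - ln (principal_minor A S)))"
      by (simp add: \<gamma>_def ln_eval_ratio[OF A r(1)] sum_distrib_right right_diff_distrib sum_subtractf mult.assoc)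
    also have "\<dots> \<le> B"
      unfolding B_def
    proof (rule sum_mono)
      fix S assume "S \<in> Pow idx"
      then have "\<bar>w S * ln t - ln (principal_minor A S)\<bar> \<le> \<bar>ln c\<bar> + \<bar>ln C\<bar>" using dev[of S] by simp
      then have "\<bar>ratio_class r S * (w S * ln t - ln (principal_minor A S))\<bar> \<le> \<bar>ratio_class r S\<bar> * (\<bar>ln c\<bar> + \<bar>ln C\<bar>)"
        unfolding abs_mult by (intro mult_left_mono) auto
      then show "ratio_class r S * (w S * ln t - ln (principal_minor A S)) \<le> \<bar>ratio_class r S\<bar> * (\<bar>ln c\<bar> + \<bar>ln C\<bar>)"
        by linarith
    qed
    finally have "\<gamma> * ln t \<le> ln (eval_ratio r A) + B" by simp
    also have "ln (eval_ratio r A) \<le> ln M" using M[OF A] eval_pos by (intro ln_mono) auto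
    finally show ?thesis by simp
  qed
  \<comment> \<open>Chosen such that \<open>\<gamma> ln t\<close> exceeds the bound by at least 1.\<close>
  define t where "t = exp ((\<bar>ln M + B\<bar> + 1) / \<gamma>)"
  have "t \<ge> 1" using \<gamma> by (simp add: t_def)
  from upper[OF this] have "\<bar>ln M + B\<bar> + 1 \<le> ln M + B" using \<gamma> by (simp add: t_def)
  then show False by linarith
qed

section \<open>Growth rates of one-parameter families\<close>

definition real_matrix :: "(nat \<Rightarrow> nat \<Rightarrow> real) \<Rightarrow> complex mat" where
  "real_matrix f = mat 4 4 (\<lambda>(i, j). of_real (f (Suc i) (Suc j)))"

lemma real_matrix_carrier: "real_matrix f \<in> carrier_mat 4 4"
  by (simp add: real_matrix_def)

lemma principal_minor_real_matrix:
  assumes "S \<subseteq> idx"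
  shows "principal_minor (real_matrix f) S = re_det S (\<lambda>i j. of_real (f i j))"
proof -
  have "index_det S (entries (real_matrix f)) = index_det S (\<lambda>i j. of_real (f i j))"
    unfolding index_det_def
  proof (intro sum.cong refl arg_cong2[where f = "(*)"] prod.cong)
    fix p i assume p: "p \<in> {p. p permutes S}" and i: "i \<in> S"
    then have "i \<in> idx" "p i \<in> idx" using assms permutes_in_image[of p S i] by auto
    then have "Suc (i - 1) = i" "Suc (p i - 1) = p i" "i - 1 < 4" "p i - 1 < 4"
      by (auto simp: idx_def)
    then show "entries (real_matrix f) i (p i) = complex_of_real (f i (p i))"
      by (simp add: entries_def real_matrix_def)
  qed
  then show ?thesis using principal_minor_eq_index_det[OF real_matrix_carrier assms] by simp
qed

definition perturbed_identity ::
    "real \<Rightarrow> (nat \<Rightarrow> real) \<Rightarrow> real \<Rightarrow> (nat \<Rightarrow> real) \<Rightarrow> nat \<Rightarrow> nat \<Rightarrow> real" where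
  "perturbed_identity \<alpha> v \<beta> w i j = (if i = j then 1 else 0) + \<alpha> * v i * v j + \<beta> * w i * w j"

lemma Cauchy_Schwarz_sum:
  fixes a b :: "nat \<Rightarrow> real"
  shows "(\<Sum>i\<in>I. a i * b i)\<^sup>2 \<le> (\<Sum>i\<in>I. (a i)\<^sup>2) * (\<Sum>i\<in>I. (b i)\<^sup>2)"
proof -
  have "0 \<le> (\<Sum>i\<in>I. \<Sum>j\<in>I. (a i * b j - a j * b i)\<^sup>2)" by (intro sum_nonneg) simp
  also have "\<dots> = (\<Sum>i\<in>I. \<Sum>j\<in>I. (a i)\<^sup>2 * (b j)\<^sup>2) + (\<Sum>i\<in>I. \<Sum>j\<in>I. (b i)\<^sup>2 * (a j)\<^sup>2)
      - 2 * (\<Sum>i\<in>I. \<Sum>j\<in>I. (a i * b i) * (a j * b j))"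
    unfolding sum_distrib_left sum.distrib[symmetric] sum_subtractf[symmetric]
    by (intro sum.cong refl) (simp add: power2_eq_square algebra_simps)
  also have "\<dots> = 2 * ((\<Sum>i\<in>I. (a i)\<^sup>2) * (\<Sum>i\<in>I. (b i)\<^sup>2) - (\<Sum>i\<in>I. a i * b i)\<^sup>2)"
    unfolding sum_product[symmetric] power2_eq_square[of "\<Sum>i\<in>I. a i * b i"] by simp
  finally show ?thesis by simp
qed

text \<open>Only the first perturbation may be negative; by the Cauchy-Schwarz inequality it is then dominated
by the identity as long as \<open>1 + \<alpha> |v|\<^sup>2\<close> stays positive.\<close>

lemma perturbed_identity_positive_definite:
  assumes \<alpha>: "0 < 1 + \<alpha> * (\<Sum>i\<in>idx. (v i)\<^sup>2)" and \<beta>: "0 \<le> \<beta>"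
  shows "positive_definite 4 (real_matrix (perturbed_identity \<alpha> v \<beta> w))"
  unfolding positive_definite_def
proof (intro conjI ballI impI)
  let ?f = "perturbed_identity \<alpha> v \<beta> w"
  let ?A = "real_matrix ?f"
  show A: "?A \<in> carrier_mat 4 4" by (rule real_matrix_carrier)
  have sym: "?f i j = ?f j i" for i j by (simp add: perturbed_identity_def mult_ac)
  show "mat_adjoint ?A = ?A"
    using A sym by (intro eq_matI) (auto simp: mat_adjoint_def mat_of_rows_index cols_nth real_matrix_def)
  fix x :: "complex vec" assume x: "x \<in> carrier_vec 4" "x \<noteq> 0\<^sub>v 4"
  define X where "X = (\<Sum>i<4. (cmod (x $ i))\<^sup>2)"
  define p where "p u = (\<Sum>i<4. of_real (u (Suc i)) * x $ i)" for u :: "nat \<Rightarrow> real"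
  have X: "0 < X"
  proof -
    obtain i where "i < 4" "x $ i \<noteq> 0" using x by (metis carrier_vecD eq_vecI index_zero_vec)
    then show ?thesis unfolding X_def by (intro sum_pos2[of _ i]) auto
  qed
  have pp: "(\<Sum>i<4. \<Sum>j<4. of_real (u (Suc i) * u (Suc j)) * x $ j * cnj (x $ i)) = of_real ((cmod (p u))\<^sup>2)" for u
    unfolding complex_norm_square p_def cnj_sum sum_product
    by (subst sum.swap) (simp add: mult_ac)
  have "(?A *\<^sub>v x) \<bullet>c x = (\<Sum>i<4. \<Sum>j<4. of_real (?f (Suc i) (Suc j)) * x $ j * cnj (x $ i))"
    using x by (simp add: scalar_prod_def real_matrix_def sum_distrib_right lessThan_atLeast0)
  also have "\<dots> = (\<Sum>i<4. \<Sum>j<4. (if i = j then x $ j * cnj (x $ i) else 0)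
      + of_real \<alpha> * (of_real (v (Suc i) * v (Suc j)) * x $ j * cnj (x $ i))
      + of_real \<beta> * (of_real (w (Suc i) * w (Suc j)) * x $ j * cnj (x $ i)))"
    by (intro sum.cong refl) (simp add: perturbed_identity_def algebra_simps)
  also have "\<dots> = of_real (X + \<alpha> * (cmod (p v))\<^sup>2 + \<beta> * (cmod (p w))\<^sup>2)"
    unfolding sum.distrib sum_distrib_left[symmetric] pp
    by (simp add: X_def complex_norm_square del: of_real_power)
  finally have "Re ((?A *\<^sub>v x) \<bullet>c x) = X + \<alpha> * (cmod (p v))\<^sup>2 + \<beta> * (cmod (p w))\<^sup>2" by simp
  moreover have "0 < X + \<alpha> * (cmod (p v))\<^sup>2"
  proof (cases "\<alpha> \<ge> 0")
    case True
    then show ?thesis using X by (simp add: add_pos_nonneg)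
  next
    case False
    have "cmod (p v) \<le> (\<Sum>i<4. \<bar>v (Suc i)\<bar> * cmod (x $ i))"
      unfolding p_def by (rule order_trans[OF norm_sum]) (simp add: norm_mult)
    then have "(cmod (p v))\<^sup>2 \<le> (\<Sum>i<4. \<bar>v (Suc i)\<bar> * cmod (x $ i))\<^sup>2"
      by (intro power_mono) auto
    also have "\<dots> \<le> (\<Sum>i<4. \<bar>v (Suc i)\<bar>\<^sup>2) * (\<Sum>i<4. (cmod (x $ i))\<^sup>2)"
      by (rule Cauchy_Schwarz_sum)
    also have "\<dots> = (\<Sum>i\<in>idx. (v i)\<^sup>2) * X"
      by (simp add: X_def idx_def eval_nat_numeral)
    finally have "\<alpha> * ((\<Sum>i\<in>idx. (v i)\<^sup>2) * X) \<le> \<alpha> * (cmod (p v))\<^sup>2"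
      using False by (intro mult_left_mono_neg) auto
    moreover have "0 < (1 + \<alpha> * (\<Sum>i\<in>idx. (v i)\<^sup>2)) * X" using \<alpha> X by simp
    ultimately show ?thesis by (simp add: algebra_simps)
  qed
  ultimately show "0 < Re ((?A *\<^sub>v x) \<bullet>c x)" using \<beta> by (simp add: add_pos_nonneg)
qed

lemma index_det_rank_one_update:
  assumes "S \<subseteq> idx"
  shows "index_det S (\<lambda>i j. (if i = j then 1 else 0) + x * u i * u j) = 1 + x * (\<Sum>i\<in>S. (u i)\<^sup>2)"
  using assms
proof (cases rule: subset_idx_list_cases)
  case (3 a b)
  then show ?thesis by (simp add: index_det_2 power2_eq_square algebra_simps)
next
  case (4 a b c)
  then show ?thesis unfolding 4(1) index_det_3[OF 4(2)] by (simp add: power2_eq_square algebra_simps)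
next
  case (5 a b c d)
  then show ?thesis unfolding 5(1) index_det_4[OF 5(2)] by (simp add: power2_eq_square algebra_simps)
qed (simp_all add: index_det_0 index_det_1 power2_eq_square)

lemma principal_minor_rank_one_update:
  assumes "S \<subseteq> idx"
  shows "principal_minor (real_matrix (perturbed_identity x v 0 w)) S = 1 + x * (\<Sum>i\<in>S. (v i)\<^sup>2)"
proof -
  have "principal_minor (real_matrix (perturbed_identity x v 0 w)) S =
      re_det S (\<lambda>i j. (if i = j then 1 else 0) + of_real x * of_real (v i) * of_real (v j))"
    unfolding principal_minor_real_matrix[OF assms] perturbed_identity_def
    by (rule arg_cong[where f = "\<lambda>f. re_det S f"]) (auto simp: fun_eq_iff)
  also have "\<dots> = Re (of_real (1 + x * (\<Sum>i\<in>S. (v i)\<^sup>2)))"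
    unfolding index_det_rank_one_update[OF assms] by simp
  finally show ?thesis by simp
qed

lemma sum_of_bool_square:
  assumes "finite S"
  shows "(\<Sum>i\<in>S. (of_bool (i \<in> K) :: real)\<^sup>2) = card (S \<inter> K)"
proof -
  have "(\<Sum>i\<in>S. (of_bool (i \<in> K) :: real)\<^sup>2) = (\<Sum>i\<in>S. if i \<in> K then 1 else 0)"
    by (rule sum.cong) auto
  then show ?thesis using assms by (simp add: sum.If_cases)
qed

text \<open>Adding \<open>t\<close> times the all-ones matrix of the block \<open>K\<close> to the identity gives the minors
\<open>1 + t |S \<inter> K|\<close>.\<close>

lemma growth_rate_meets:
  assumes K: "K \<subseteq> idx" "K \<noteq> {}"
  shows "growth_rate (\<lambda>S. if S \<inter> K = {} then 0 else 1)"
proof -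
  define A where "A t = real_matrix (perturbed_identity t (\<lambda>i. of_bool (i \<in> K)) 0 (\<lambda>_. 0))" for t
  have pd: "positive_definite 4 (A t)" if t: "1 \<le> t" for t
    unfolding A_def using t by (intro perturbed_identity_positive_definite) (auto intro!: add_pos_nonneg mult_nonneg_nonneg sum_nonneg)
  have "1 * t powr (if S \<inter> K = {} then 0 else 1) \<le> principal_minor (A t) S \<and>
      principal_minor (A t) S \<le> 5 * t powr (if S \<inter> K = {} then 0 else 1)" if t: "1 \<le> t" and S: "S \<subseteq> idx" for t S
  proof -
    have fin: "finite S" using S by (simp add: finite_subset idx_def)
    have d: "principal_minor (A t) S = 1 + t * card (S \<inter> K)"
      unfolding A_def principal_minor_rank_one_update[OF S] sum_of_bool_square[OF fin] ..
    have "card (S \<inter> K) \<le> card idx" using S by (intro card_mono) (auto simp: idx_def)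
    then have le: "real (card (S \<inter> K)) \<le> 4" by (simp add: idx_def)
    show ?thesis
    proof (cases "S \<inter> K = {}")
      case True
      then show ?thesis using t by (simp add: d)
    next
      case False
      then have "1 \<le> card (S \<inter> K)" using fin by (simp add: Suc_le_eq card_gt_0_iff)
      then have "1 \<le> real (card (S \<inter> K))" by simp
      then have "t * 1 \<le> t * real (card (S \<inter> K))" "t * real (card (S \<inter> K)) \<le> t * 4"
        using t le by (auto intro: mult_left_mono)
      then have "t \<le> principal_minor (A t) S" "principal_minor (A t) S \<le> 5 * t"
        unfolding d using t by linarith+
      then show ?thesis using t False by simp
    qed
  qed
  from growth_rateI[of 1 A, OF _ pd this] show ?thesis by simp
qed

text \<open>Here a multiple of the all-ones matrix of the block \<open>K\<close> is subtracted, chosen so that the minor of \<open>K\<close> is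
exactly \<open>1 / t\<close>, whereas minors of sets not containing \<open>K\<close> stay away from 0.\<close>

lemma growth_rate_contains:
  assumes K: "K \<subseteq> idx" "K \<noteq> {}"
  shows "growth_rate (\<lambda>S. if K \<subseteq> S then - 1 else 0)"
proof -
  define k where "k = real (card K)"
  have finK: "finite K" using K by (simp add: finite_subset idx_def)
  have k: "1 \<le> k" "k \<le> 4"
    using K finK card_mono[of idx K] by (auto simp: k_def idx_def Suc_le_eq card_gt_0_iff)
  \<comment> \<open>The solution of \<open>1 - x k = 1 / t\<close>.\<close>
  define x where "x t = (1 - 1 / t) / k" for t :: real
  have x: "0 \<le> x t" "x t * k = 1 - 1 / t" if "1 \<le> t" for t using that k by (auto simp: x_def)
  define A where "A t = real_matrix (perturbed_identity (- x t) (\<lambda>i. of_bool (i \<in> K)) 0 (\<lambda>_. 0))" for t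
  have "idx \<inter> K = K" using K by blast
  then have pd: "positive_definite 4 (A t)" if "1 \<le> t" for t
    unfolding A_def using that x[OF that] sum_of_bool_square[of idx K]
    by (intro perturbed_identity_positive_definite) (simp_all add: k_def idx_def)
  have "1 / 4 * t powr (if K \<subseteq> S then - 1 else 0) \<le> principal_minor (A t) S \<and>
      principal_minor (A t) S \<le> 1 * t powr (if K \<subseteq> S then - 1 else 0)" if t: "1 \<le> t" and S: "S \<subseteq> idx" for t S
  proof -
    note x = x[OF t]
    have fin: "finite S" using S by (simp add: finite_subset idx_def)
    have d: "principal_minor (A t) S = 1 - x t * card (S \<inter> K)"
      unfolding A_def principal_minor_rank_one_update[OF S] sum_of_bool_square[OF fin] by simp
    show ?thesis
    proof (cases "K \<subseteq> S")
      case True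
      then have "S \<inter> K = K" by blast
      then have "principal_minor (A t) S = 1 / t" using d x by (simp add: k_def)
      then show ?thesis using t True by (simp add: powr_minus_divide field_simps)
    next
      case False
      then have "S \<inter> K \<subset> K" by blast
      then have "card (S \<inter> K) < card K" using finK by (rule psubset_card_mono[rotated])
      then have c: "real (card (S \<inter> K)) \<le> k - 1" unfolding k_def by linarith
      have "x t * real (card (S \<inter> K)) \<le> x t * (k - 1)" using c x by (intro mult_left_mono) auto
      also have "\<dots> \<le> 1 / k * (k - 1)"
        using t k by (intro mult_right_mono) (auto simp: x_def divide_right_mono)
      also have "\<dots> \<le> 3 / 4" using k by (simp add: field_simps)
      finally show ?thesis using t False x by (simp add: d)
    qed
  qed
  from growth_rateI[of "1 / 4" A, OF _ pd this] show ?thesis by simp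
qed

lemma all_subset_insert:
  "(\<forall>S. S \<subseteq> insert a B \<longrightarrow> P S) \<longleftrightarrow> (\<forall>S. S \<subseteq> B \<longrightarrow> P S) \<and> (\<forall>S. S \<subseteq> B \<longrightarrow> P (insert a S))"
proof (intro iffI allI impI conjI)
  fix S assume "(\<forall>S. S \<subseteq> B \<longrightarrow> P S) \<and> (\<forall>S. S \<subseteq> B \<longrightarrow> P (insert a S))" "S \<subseteq> insert a B"
  then show "P S" by (cases "a \<in> S") (metis insert_Diff subset_insert_iff, metis subset_insert)
qed blast+

text \<open>The coefficient of \<open>t\<^sup>2\<close> is the Gram determinant of \<open>v\<close> and \<open>w\<close> restricted to \<open>S\<close>. The four vectors
\<open>(v a, w a)\<close> in the plane are pairwise independent if \<open>s = - 1\<close>; if \<open>s = 1\<close>, those for \<open>k\<close> and \<open>l\<close>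
coincide.\<close>

lemma index_det_rank_two_update:
  fixes v w :: "nat \<Rightarrow> complex"
  assumes ijkl: "distinct [i, j, k, l]" and s: "s = 1 \<or> s = - 1"
    and vw: "v i = 1" "v j = 0" "v k = 1" "v l = 1" "w i = 0" "w j = 1" "w k = 1" "w l = s"
  shows "\<forall>S. S \<subseteq> {i, j, k, l} \<longrightarrow>
      index_det S (\<lambda>a b. (if a = b then 1 else 0) + t * v a * v b + t * w a * w b) =
      1 + t * (\<Sum>a\<in>S. v a ^ 2 + w a ^ 2)
        + t\<^sup>2 * ((\<Sum>a\<in>S. v a ^ 2) * (\<Sum>a\<in>S. w a ^ 2) - (\<Sum>a\<in>S. v a * w a)\<^sup>2)"
  unfolding all_subset_insert using ijkl s
  by (elim disjE)
    (simp_all add: vw index_det_0 index_det_1 index_det_2 index_det_3 index_det_4 power2_eq_square algebra_simps)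

text \<open>The growth rate is the rank function of the four plane vectors in \<open>index_det_rank_two_update\<close>.\<close>

lemma growth_rate_rank_two:
  assumes idx: "idx = {i, j, k, l}" and ijkl: "distinct [i, j, k, l]" and s: "s = 1 \<or> s = - 1"
  shows "growth_rate (\<lambda>S. if S = {} then 0 else if card S = 1 \<or> S \<subseteq> {k, l} \<and> s = (1::real) then 1 else 2)"
    (is "growth_rate ?w")
proof -
  define v w :: "nat \<Rightarrow> real" where "v a = (if a = j then 0 else 1)"
    and "w a = (if a = i then 0 else if a = l then s else 1)" for a
  have vw: "v i = 1" "v j = 0" "v k = 1" "v l = 1" "w i = 0" "w j = 1" "w k = 1" "w l = s"
    using ijkl by (auto simp: v_def w_def)
  define A where "A t = real_matrix (perturbed_identity t v t w)" for t
  have pd: "positive_definite 4 (A t)" if "1 \<le> t" for t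
    unfolding A_def using that
    by (intro perturbed_identity_positive_definite) (auto intro!: add_pos_nonneg mult_nonneg_nonneg sum_nonneg)
  have minors: "principal_minor (A t) S = 1 + t * (\<Sum>a\<in>S. v a ^ 2 + w a ^ 2)
      + t\<^sup>2 * ((\<Sum>a\<in>S. v a ^ 2) * (\<Sum>a\<in>S. w a ^ 2) - (\<Sum>a\<in>S. v a * w a)\<^sup>2)" (is "_ = ?m t S")
    if S: "S \<subseteq> idx" for t S
  proof -
    let ?F = "\<lambda>a b. (if a = b then 1 else 0) + complex_of_real t * of_real (v a) * of_real (v b)
        + of_real t * of_real (w a) * of_real (w b)"
    have "principal_minor (A t) S = re_det S ?F"
      unfolding A_def principal_minor_real_matrix[OF S] perturbed_identity_def
      by (rule arg_cong[where f = "\<lambda>f. re_det S f"]) (auto simp: fun_eq_iff)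
    moreover have "complex_of_real s = 1 \<or> complex_of_real s = - 1" using s by auto
    with index_det_rank_two_update[OF ijkl this, of "\<lambda>a. of_real (v a)" "\<lambda>a. of_real (w a)" "of_real t"]
    have "index_det S ?F = of_real (?m t S)"
      using S vw idx by simp
    ultimately show ?thesis by simp
  qed
  have "1 * t powr ?w S \<le> principal_minor (A t) S \<and> principal_minor (A t) S \<le> 16 * t powr ?w S"
    if t: "1 \<le> t" and S: "S \<subseteq> idx" for t S
  proof -
    have t2: "1 \<le> t\<^sup>2" "t \<le> t\<^sup>2" using t by (simp_all add: one_le_power self_le_power)
    have "\<forall>S. S \<subseteq> {i, j, k, l} \<longrightarrow> 1 * t powr ?w S \<le> ?m t S \<and> ?m t S \<le> 16 * t powr ?w S"
      unfolding all_subset_insert using ijkl s t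
      by (elim disjE, auto simp: vw card_insert_if, (use t2 in linarith)+)
    then show ?thesis unfolding minors[OF S] using S idx by blast
  qed
  from growth_rateI[of 1 A, OF _ pd this] show ?thesis by simp
qed

section \<open>Double description of polyhedral cones\<close>

text \<open>Vectors are real functions on the natural numbers. The inductive form makes it easy to transport
combinations of generators elsewhere; \<open>cone_coefficients\<close> recovers the coefficients.\<close>

inductive_set cone :: "(nat \<Rightarrow> real) set \<Rightarrow> (nat \<Rightarrow> real) set" for R where
  cone_zero: "(\<lambda>i. 0) \<in> cone R"
| cone_add: "r \<in> R \<Longrightarrow> 0 \<le> a \<Longrightarrow> x \<in> cone R \<Longrightarrow> (\<lambda>i. a * r i + x i) \<in> cone R"

lemma cone_plus:
  assumes "x \<in> cone R" "y \<in> cone R"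
  shows "(\<lambda>i. x i + y i) \<in> cone R"
  using assms(1)
proof induction
  case cone_zero
  then show ?case using assms(2) by simp
next
  case (cone_add r a x)
  then show ?case using cone.cone_add[OF cone_add(1,2) cone_add(4)] by (simp add: add.assoc)
qed

lemma cone_scale:
  assumes "x \<in> cone R" "0 \<le> c"
  shows "(\<lambda>i. c * x i) \<in> cone R"
  using assms(1)
proof induction
  case cone_zero
  then show ?case using cone.cone_zero by simp
next
  case (cone_add r a x)
  have "(\<lambda>i. (c * a) * r i + c * x i) \<in> cone R"
    using cone_add assms(2) by (intro cone.cone_add) auto
  then show ?case by (simp add: distrib_left mult.assoc)
qed

lemma cone_generator: "r \<in> R \<Longrightarrow> r \<in> cone R"
  using cone_add[of r R 1 "\<lambda>i. 0"] cone_zero by simp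

lemma cone_sum:
  assumes "finite I" "\<And>j. j \<in> I \<Longrightarrow> x j \<in> cone R" "\<And>j. j \<in> I \<Longrightarrow> 0 \<le> c j"
  shows "(\<lambda>i. \<Sum>j\<in>I. c j * x j i) \<in> cone R"
  using assms
proof (induction I)
  case (insert j I)
  then show ?case using cone_plus[OF cone_scale[of "x j" R "c j"]] by simp
qed (simp add: cone_zero)

lemma cone_coefficients:
  assumes "finite R" "x \<in> cone R"
  obtains c where "\<And>r. r \<in> R \<Longrightarrow> 0 \<le> c r" "x = (\<lambda>i. \<Sum>r\<in>R. c r * r i)"
proof -
  have "\<exists>c. (\<forall>r\<in>R. 0 \<le> c r) \<and> x = (\<lambda>i. \<Sum>r\<in>R. c r * r i)"
    using assms(2)
  proof induction
    case cone_zero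
    show ?case by (intro exI[of _ "\<lambda>_. 0"]) simp
  next
    case (cone_add r a x)
    then obtain c where c: "\<forall>r\<in>R. 0 \<le> c r" "x = (\<lambda>i. \<Sum>r\<in>R. c r * r i)" by blast
    have "(\<Sum>s\<in>R. (c s + (if s = r then a else 0)) * s i) = a * r i + x i" for i
      using assms(1) cone_add(1)
      by (simp add: c(2) distrib_right sum.distrib if_distrib[of "\<lambda>u. u * _"] sum.delta cong: if_cong)
    then show ?case using c(1) cone_add(2) by (intro exI[of _ "\<lambda>s. c s + (if s = r then a else 0)"]) auto
  qed
  then show thesis using that by blast
qed

text \<open>The step of the double description method (Motzkin): the part of a cone in the half space of
nonnegative \<open>k\<close>-th coordinate is generated by the generators in the half space together with the
combinations, with vanishing \<open>k\<close>-th coordinate, of a generator inside and one outside.\<close>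

lemma cone_halfspace:
  fixes R :: "(nat \<Rightarrow> real) set"
  assumes fin: "finite R" and x: "x \<in> cone R" "0 \<le> x k"
    and keep: "\<And>r. r \<in> R \<Longrightarrow> 0 \<le> r k \<Longrightarrow> r \<in> cone R'"
    and comb: "\<And>p q. p \<in> R \<Longrightarrow> q \<in> R \<Longrightarrow> p k < 0 \<Longrightarrow> 0 < q k \<Longrightarrow> (\<lambda>i. q k * p i - p k * q i) \<in> cone R'"
  shows "x \<in> cone R'"
proof -
  obtain c where c: "\<And>r. r \<in> R \<Longrightarrow> 0 \<le> c r" "x = (\<lambda>i. \<Sum>r\<in>R. c r * r i)"
    using cone_coefficients[OF fin x(1)] by blast
  define N P where "N = {r \<in> R. r k < 0}" and "P = {r \<in> R. 0 \<le> r k}"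
  have NP: "finite N" "finite P" "R = P \<union> N" "P \<inter> N = {}" using fin by (auto simp: N_def P_def)
  define \<alpha> \<beta> where "\<alpha> = (\<Sum>q\<in>P. c q * q k)" and "\<beta> = - (\<Sum>p\<in>N. c p * p k)"
  have xi: "x i = (\<Sum>q\<in>P. c q * q i) + (\<Sum>p\<in>N. c p * p i)" for i
    using NP by (simp add: c(2) sum.union_disjoint)
  have "0 \<le> \<beta>" unfolding \<beta>_def using c(1) by (auto simp: N_def intro!: sum_nonpos mult_nonneg_nonpos)
  moreover have "\<beta> \<le> \<alpha>" using x(2) xi[of k] by (simp add: \<alpha>_def \<beta>_def)
  ultimately have \<alpha>\<beta>: "0 \<le> \<beta>" "\<beta> \<le> \<alpha>" "0 \<le> \<alpha>" by simp_all
  have Pcone: "(\<lambda>i. \<Sum>q\<in>P. c q * q i) \<in> cone R'"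
    using cone_sum[OF NP(2), of "\<lambda>q. q" R' c] keep c(1) by (auto simp: P_def)
  show ?thesis
  proof (cases "\<beta> = 0")
    case True
    have "(\<Sum>p\<in>N. - (c p * p k)) = 0" using True by (simp add: \<beta>_def sum_negf)
    then have "\<forall>p\<in>N. - (c p * p k) = 0"
      by (subst (asm) sum_nonneg_eq_0_iff[OF NP(1)])
        (use c(1) in \<open>auto simp: N_def intro: mult_nonneg_nonpos\<close>)
    then have "\<forall>p\<in>N. c p = 0" by (auto simp: N_def)
    then have "x = (\<lambda>i. \<Sum>q\<in>P. c q * q i)" using xi by (simp add: fun_eq_iff)
    then show ?thesis using Pcone by simp
  next
    case False
    then have \<alpha>: "0 < \<alpha>" using \<alpha>\<beta> by simp
    \<comment> \<open>The share \<open>\<beta> / \<alpha>\<close> of the inner part balances the outer part; distributing both over all pairs gives the combinations.\<close>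
    let ?w = "\<lambda>(p, q). c p * c q / \<alpha>" and ?v = "\<lambda>(p, q) i. q k * p i - p k * (q i :: real)"
    have "?v pq \<in> cone R'" if pq: "pq \<in> N \<times> P" for pq
    proof -
      obtain p q where [simp]: "pq = (p, q)" by (cases pq)
      have pq': "p \<in> R" "q \<in> R" "p k < 0" "0 \<le> q k" using pq by (auto simp: N_def P_def)
      show ?thesis
      proof (cases "q k = 0")
        case True
        then show ?thesis using cone_scale[OF keep[OF pq'(2,4)], of "- p k"] pq'(3) by simp
      next
        case False
        then show ?thesis using comb[OF pq'(1-3)] pq'(4) by simp
      qed
    qed
    moreover have "0 \<le> ?w pq" if "pq \<in> N \<times> P" for pq
      using that c(1) \<alpha> by (auto simp: N_def P_def)
    ultimately have "(\<lambda>i. \<Sum>pq\<in>N \<times> P. ?w pq * ?v pq i) \<in> cone R'"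
      using cone_sum[of "N \<times> P" ?v R' ?w] NP(1,2) by blast
    moreover have "(\<lambda>i. (1 - \<beta> / \<alpha>) * (\<Sum>q\<in>P. c q * q i)) \<in> cone R'"
      using cone_scale[OF Pcone, of "1 - \<beta> / \<alpha>"] \<alpha> \<alpha>\<beta> by simp
    ultimately have "(\<lambda>i. (1 - \<beta> / \<alpha>) * (\<Sum>q\<in>P. c q * q i) + (\<Sum>pq\<in>N \<times> P. ?w pq * ?v pq i)) \<in> cone R'"
      by (rule cone_plus[rotated])
    moreover have "(1 - \<beta> / \<alpha>) * (\<Sum>q\<in>P. c q * q i) + (\<Sum>pq\<in>N \<times> P. ?w pq * ?v pq i) = x i" for i
    proof -
      have "(\<Sum>pq\<in>N \<times> P. ?w pq * ?v pq i) =
          (\<Sum>p\<in>N. \<Sum>q\<in>P. (c p * p i) * (c q * q k) / \<alpha> - (c p * p k) * (c q * q i) / \<alpha>)"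
        unfolding sum.cartesian_product by (intro sum.cong refl) (auto simp: diff_divide_distrib algebra_simps)
      also have "\<dots> = (\<Sum>p\<in>N. c p * p i) * \<alpha> / \<alpha> + \<beta> * (\<Sum>q\<in>P. c q * q i) / \<alpha>"
        unfolding \<alpha>_def \<beta>_def sum_subtractf sum_divide_distrib[symmetric] sum_product[symmetric] by simp
      finally show ?thesis using \<alpha> by (simp add: xi field_simps)
    qed
    ultimately show ?thesis by (simp add: fun_eq_iff)
  qed
qed

definition coord :: "int list \<Rightarrow> nat \<Rightarrow> real" where
  "coord r i = (if i < length r then of_int (r ! i) else 0)"

definition combine :: "nat \<Rightarrow> int list \<Rightarrow> int list \<Rightarrow> int list" where
  "combine k p q = (let a = q ! k; b = p ! k in map2 (\<lambda>u v. a * u - b * v) p q)"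

text \<open>Dividing by the greatest common divisor keeps the numbers in the computation small.\<close>

definition primitive :: "int list \<Rightarrow> int list" where
  "primitive r = (let g = Gcd (set r) in map (\<lambda>u. u div g) r)"

text \<open>Comparison of the first \<open>m\<close> coordinates.\<close>

fun vector_le :: "nat \<Rightarrow> int list \<Rightarrow> int list \<Rightarrow> bool" where
  "vector_le (Suc m) (x # xs) (y # ys) \<longleftrightarrow> x \<le> y \<and> vector_le m xs ys"
| "vector_le _ _ _ \<longleftrightarrow> True"

definition reduce :: "nat \<Rightarrow> int list \<Rightarrow> int list \<Rightarrow> int list" where
  "reduce m r v = (if vector_le m r v then map2 (-) v r else v)"

text \<open>Subtracts each generator up to three times, as long as it fits. The recursion matches on the vector as
well, so that rewriting unfolds it only for an explicitly given vector, and not below an abstraction.\<close>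

fun remainder :: "nat \<Rightarrow> int list list \<Rightarrow> int list \<Rightarrow> int list" where
  "remainder m R [] = []"
| "remainder m [] (x # v) = x # v"
| "remainder m (r # R) (x # v) = remainder m R (reduce m r (reduce m r (reduce m r (x # v))))"

text \<open>A greedy attempt to write \<open>v\<close> as a combination of elements of \<open>R\<close>. Success certifies membership in
the cone; failure means nothing. Comparing only the first \<open>m\<close> coordinates amounts to remaining in the
cone given by the half spaces treated so far.\<close>

definition decomposes :: "nat \<Rightarrow> int list list \<Rightarrow> int list \<Rightarrow> bool" where
  "decomposes m R v \<longleftrightarrow> list_all (\<lambda>u. u = 0) (remainder m R v)"

text \<open>Two extreme rays of a cone defined by nonnegativity of the first \<open>k\<close> coordinates span a face of
dimension two iff no third extreme ray vanishes wherever both of them do. By this test \<open>dd_step\<close> selects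
the combinations to keep; it requires all others to decompose.\<close>

definition adjacent :: "nat \<Rightarrow> int list list \<Rightarrow> int list \<Rightarrow> int list \<Rightarrow> bool" where
  "adjacent k R p q \<longleftrightarrow> list_all (\<lambda>r. r = p \<or> r = q \<or>
     list_ex (\<lambda>(u, v, w). u = 0 \<and> v = 0 \<and> w \<noteq> 0) (take k (zip p (zip q r)))) R"

definition dd_step :: "nat \<Rightarrow> int list list \<Rightarrow> int list list option" where
  "dd_step k R =
    (let neg = filter (\<lambda>r. r ! k < 0) R; pos = filter (\<lambda>r. 0 < r ! k) R; zer = filter (\<lambda>r. r ! k = 0) R;
         (adj, rest) = List.partition (\<lambda>(p, q). adjacent k R p q) (List.product neg pos);
         R' = map (\<lambda>(p, q). primitive (combine k p q)) adj @ pos @ zer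
     in if list_all (\<lambda>(p, q). decomposes (Suc k) R' (combine k p q)) rest then Some R' else None)"

fun dd_run :: "nat list \<Rightarrow> int list list \<Rightarrow> int list list option" where
  "dd_run [] R = Some R"
| "dd_run (k # ks) R = (case dd_step k R of None \<Rightarrow> None | Some R' \<Rightarrow> dd_run ks R')"

abbreviation list_cone :: "int list list \<Rightarrow> (nat \<Rightarrow> real) set" where
  "list_cone R \<equiv> cone (coord ` set R)"

lemma coord_map2:
  assumes "length p = length q" "f 0 0 = 0"
  shows "coord (map2 f p q) i = of_int (f (if i < length p then p ! i else 0) (if i < length p then q ! i else 0))"
  using assms by (simp add: coord_def)

lemma coord_combine:
  assumes "length p = n" "length q = n" "k < n"
  shows "coord (combine k p q) = (\<lambda>i. coord q k * coord p i - coord p k * coord q i)"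
  using assms by (simp add: combine_def Let_def fun_eq_iff coord_map2) (simp add: coord_def)

lemma length_combine: "length p = n \<Longrightarrow> length q = n \<Longrightarrow> length (combine k p q) = n"
  by (simp add: combine_def Let_def)

lemma coord_primitive: "coord r = (\<lambda>i. of_int (Gcd (set r)) * coord (primitive r) i)"
proof
  fix i
  have "r ! i = Gcd (set r) * (r ! i div Gcd (set r))" if "i < length r"
    using that by (simp add: Gcd_dvd)
  then show "coord r i = of_int (Gcd (set r)) * coord (primitive r) i"
    by (simp add: coord_def primitive_def Let_def flip: of_int_mult)
qed

lemma length_reduce: "length r = n \<Longrightarrow> length v = n \<Longrightarrow> length (reduce m r v) = n"
  by (simp add: reduce_def)

lemma remainder_Nil: "remainder m [] v = v"
  by (cases v) simp_all

lemma remainder_Cons: "remainder m (r # R) v = remainder m R (reduce m r (reduce m r (reduce m r v)))"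
  by (cases v) (simp_all add: reduce_def)

lemma reduce_sound:
  assumes "length r = n" "length v = n" "r \<in> set R" "coord (reduce m r v) \<in> list_cone R"
  shows "coord v \<in> list_cone R"
proof (cases "vector_le m r v")
  case True
  have "coord v = (\<lambda>i. coord r i + coord (reduce m r v) i)"
    using assms(1,2) True by (simp add: reduce_def fun_eq_iff coord_map2) (simp add: coord_def)
  then show ?thesis using cone_plus[OF cone_generator assms(4)] assms(3) by simp
next
  case False
  then show ?thesis using assms(4) by (simp add: reduce_def)
qed

lemma decomposes_sound:
  assumes R: "\<And>r. r \<in> set R \<Longrightarrow> length r = n" and v: "length v = n" and dec: "decomposes m R v"
  shows "coord v \<in> list_cone R"
proof -
  have "coord v \<in> list_cone R"
    if "set Q \<subseteq> set R" "length v = n"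
      "list_all (\<lambda>u. u = 0) (remainder m Q v)" for Q v
    using that
  proof (induction Q arbitrary: v)
    case Nil
    then have "coord v = (\<lambda>i. 0)" by (auto simp: coord_def list_all_length remainder_Nil)
    then show ?case using cone_zero by simp
  next
    case (Cons r Q)
    have r: "length r = n" "r \<in> set R" using Cons.prems R by auto
    have len: "length (reduce m r v) = n" "length (reduce m r (reduce m r v)) = n"
      "length (reduce m r (reduce m r (reduce m r v))) = n"
      using length_reduce[OF r(1)] Cons.prems(2) by blast+
    have "coord (reduce m r (reduce m r (reduce m r v))) \<in> list_cone R"
      by (rule Cons.IH) (use Cons.prems len in \<open>simp_all add: remainder_Cons\<close>)
    then have "coord (reduce m r (reduce m r v)) \<in> list_cone R" by (rule reduce_sound[OF r(1) len(2) r(2)])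
    then have "coord (reduce m r v) \<in> list_cone R" by (rule reduce_sound[OF r(1) len(1) r(2)])
    then show ?case by (rule reduce_sound[OF r(1) Cons.prems(2) r(2)])
  qed
  then show ?thesis using v dec unfolding decomposes_def by blast
qed

lemma dd_step_sound:
  assumes step: "dd_step k R = Some R'" and R: "\<And>r. r \<in> set R \<Longrightarrow> length r = n" and k: "k < n"
  shows "\<forall>r\<in>set R'. length r = n"
    and "x \<in> list_cone R \<Longrightarrow> 0 \<le> x k \<Longrightarrow> x \<in> list_cone R'"
proof -
  define neg pos where "neg = filter (\<lambda>r. r ! k < 0) R" and "pos = filter (\<lambda>r. 0 < r ! k) R"
  have R': "R' = map (\<lambda>(p, q). primitive (combine k p q)) (filter (\<lambda>(p, q). adjacent k R p q) (List.product neg pos))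
      @ pos @ filter (\<lambda>r. r ! k = 0) R"
    and dec: "\<And>p q. p \<in> set neg \<Longrightarrow> q \<in> set pos \<Longrightarrow> \<not> adjacent k R p q \<Longrightarrow> decomposes (Suc k) R' (combine k p q)"
    using step by (auto simp: dd_step_def Let_def neg_def pos_def list_all_iff split: if_splits)
  show len: "\<forall>r\<in>set R'. length r = n"
    using R by (auto simp: R' neg_def pos_def primitive_def Let_def length_combine)
  assume x: "x \<in> list_cone R" "0 \<le> x k"
  have coord_k: "coord r k = of_int (r ! k)" if "r \<in> set R" for r using R[OF that] k by (simp add: coord_def)
  show "x \<in> list_cone R'"
  proof (rule cone_halfspace[OF _ x])
    fix u assume "u \<in> coord ` set R" "0 \<le> u k"
    then obtain r where r: "r \<in> set R" "u = coord r" "0 \<le> r ! k" using coord_k by auto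
    then have "r \<in> set R'" by (auto simp: R' pos_def)
    then show "u \<in> list_cone R'" unfolding r(2) by (intro cone_generator) simp
  next
    fix u v assume "u \<in> coord ` set R" "v \<in> coord ` set R" "u k < 0" "0 < v k"
    then obtain p q where p: "p \<in> set R" "u = coord p" "p ! k < 0" and q: "q \<in> set R" "v = coord q" "0 < q ! k"
      using coord_k by auto
    have pq: "p \<in> set neg" "q \<in> set pos" using p q by (auto simp: neg_def pos_def)
    have "coord (combine k p q) \<in> list_cone R'"
    proof (cases "adjacent k R p q")
      case True
      then have "coord (primitive (combine k p q)) \<in> list_cone R'"
        using pq by (intro cone_generator imageI) (force simp: R')
      then show ?thesis unfolding coord_primitive[of "combine k p q"] by (intro cone_scale) simp_all
    next
      case False
      then show ?thesis using dec[OF pq False] len R p(1) q(1)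
        by (intro decomposes_sound[of R' n]) (auto intro: length_combine)
    qed
    then show "(\<lambda>i. v k * u i - u k * v i) \<in> list_cone R'"
      using coord_combine[of p n q k] R p q k by simp
  qed simp
qed

lemma dd_run_sound:
  assumes "dd_run ks R = Some R'" "\<And>r. r \<in> set R \<Longrightarrow> length r = n" "\<And>k. k \<in> set ks \<Longrightarrow> k < n"
    "x \<in> list_cone R" "\<And>k. k \<in> set ks \<Longrightarrow> 0 \<le> x k"
  shows "x \<in> list_cone R'"
  using assms
proof (induction ks arbitrary: R)
  case (Cons k ks)
  obtain Q where Q: "dd_step k R = Some Q" "dd_run ks Q = Some R'"
    using Cons.prems(1) by (cases "dd_step k R") auto
  show ?case
    using Cons.IH[OF Q(2)] dd_step_sound[OF Q(1), of n] Cons.prems by simp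
qed simp

section \<open>The cone of bounded ratios\<close>

text \<open>The index sets whose superset sums serve as coordinates: the pairs, the triples and the full set. The
triples are listed by their missing element, so that the coordinates are \<open>a12, a13, a14, a23, a24, a34,
b1, b2, b3, b4, c\<close>.\<close>

definition moebius_sets :: "nat list list" where
  "moebius_sets = [[1,2], [1,3], [1,4], [2,3], [2,4], [3,4], [2,3,4], [1,3,4], [1,2,4], [1,2,3], [1,2,3,4]]"

text \<open>The inequalities besides nonnegativity of the coordinates. Their order does not change the cone, but it
governs the number of intermediate generators; taking triples before pairs makes the computation
about twice as long.\<close>

definition facets :: "int list list" where
  "facets =
    [[0,0,0,0,0,0, 1,1,1,1, -2],
     [1,0,0,0,0,0, 1,1,0,0, -1],
     [0,1,0,0,0,0, 1,0,1,0, -1],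
     [0,0,1,0,0,0, 1,0,0,1, -1],
     [0,0,0,1,0,0, 0,1,1,0, -1],
     [0,0,0,0,1,0, 0,1,0,1, -1],
     [0,0,0,0,0,1, 0,0,1,1, -1],
     [0,0,0,1,1,1, -1,0,0,0, 0],
     [0,1,1,0,0,1, 0,-1,0,0, 0],
     [1,0,1,0,1,0, 0,0,-1,0, 0],
     [1,1,0,1,0,0, 0,0,0,-1, 0],
     [1,1,1,1,1,1, -1,-1,-1,-1, 1]]"

text \<open>The generators of the orthant, each followed by its values on the facets. In these 23 coordinates every
half space in question is given by the nonnegativity of a single coordinate.\<close>

definition unit_rays :: "int list list" where
  "unit_rays = map (\<lambda>j. map (\<lambda>i. if i = j then 1 else 0) [0..<11] @ map (\<lambda>f. f ! j) facets) [0..<11]"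

text \<open>Lists in place of sets make the orbits of the basic ratios computable by rewriting.\<close>

definition basic_lists :: "(nat list list \<times> nat list list) list" where
  "basic_lists =
    [([[1,2], []], [[1], [2]]),
     ([[1,2,3], [1]], [[1,2], [1,3]]),
     ([[1,2,4], [1,3,4], [2,3], [1], [4]], [[1,2], [1,3], [1,4], [2,4], [3,4]]),
     ([[1,2,3,4], [1,2,3,4], [2,3], [2,4], [3,4], [1], []],
      [[1,2,3], [1,2,4], [1,3,4], [2,3,4], [2], [3], [4]]),
     ([[1,2,3,4], [2,3], [2,4], [3,4], [1], [1], []],
      [[2,3,4], [1,2], [1,3], [1,4], [2], [3], [4]])]"

definition permutation_lists :: "nat list list" where
  "permutation_lists = filter distinct (List.n_lists 4 [1,2,3,4])"

definition list_symmetry :: "bool \<Rightarrow> nat list \<Rightarrow> nat list \<Rightarrow> nat list" where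
  "list_symmetry compl p S =
    (let T = map (\<lambda>i. p ! (i - 1)) S in if compl then filter (\<lambda>i. i \<notin> set T) [1,2,3,4] else T)"

definition count_supersets :: "nat list \<Rightarrow> nat list list \<Rightarrow> int" where
  "count_supersets K Ss = int (length (filter (\<lambda>S. list_all (\<lambda>i. i \<in> set S) K) Ss))"

definition generator_coordinates :: "bool \<times> nat list \<times> nat list list \<times> nat list list \<Rightarrow> int list" where
  "generator_coordinates = (\<lambda>(compl, p, num, den).
    let num' = map (list_symmetry compl p) num; den' = map (list_symmetry compl p) den
    in map (\<lambda>K. count_supersets K num' - count_supersets K den') moebius_sets)"

text \<open>The generators found by the double description method, restricted to the first 11 coordinates, are
coordinate vectors of ratios in the orbits of the basic ones.\<close>

definition dd_certificate :: bool where
  "dd_certificate = (case dd_run [11..<23] unit_rays of None \<Rightarrow> False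
    | Some R \<Rightarrow>
       (let G = map generator_coordinates (List.product [False, True] (List.product permutation_lists basic_lists))
        in list_all (\<lambda>r. take 11 r \<in> set G) R))"

lemma dd_certificate: dd_certificate
  unfolding dd_certificate_def by code_simp

lemma sum_Pow_idx:
  fixes f :: "nat set \<Rightarrow> real"
  shows "(\<Sum>S\<in>Pow idx. f S) =
    f {} + f {1} + f {2} + f {3} + f {4} + f {1,2} + f {1,3} + f {1,4} + f {2,3} + f {2,4} + f {3,4}
    + f {1,2,3} + f {1,2,4} + f {1,3,4} + f {2,3,4} + f {1,2,3,4}"
proof -
  have step: "(\<Sum>S\<in>Pow (insert a A). g S) = (\<Sum>S\<in>Pow A. g S) + (\<Sum>S\<in>Pow A. g (insert a S))"
    if "finite A" "a \<notin> A" for a A and g :: "nat set \<Rightarrow> real"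
  proof -
    have "inj_on (insert a) (Pow A)" "Pow A \<inter> insert a ` Pow A = {}"
      using that(2) by (auto simp: inj_on_def)
    then show ?thesis using that(1) by (simp add: Pow_insert sum.union_disjoint sum.reindex)
  qed
  show ?thesis unfolding idx_def by (simp add: step)
qed

definition superset_sum :: "(nat set \<Rightarrow> real) \<Rightarrow> nat set \<Rightarrow> real" where
  "superset_sum e K = (\<Sum>S\<in>Pow idx. if K \<subseteq> S then e S else 0)"

definition moebius_coordinate :: "(nat set \<Rightarrow> real) \<Rightarrow> nat \<Rightarrow> real" where
  "moebius_coordinate e i = superset_sum e (set (moebius_sets ! i))"

text \<open>Moebius inversion, by induction on the size of the complement.\<close>

lemma superset_sums_determine:
  assumes "\<And>K. K \<subseteq> idx \<Longrightarrow> superset_sum e K = superset_sum e' K" "S \<subseteq> idx"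
  shows "e S = e' S"
  using assms(2)
proof (induction "card (idx - S)" arbitrary: S rule: less_induct)
  case less
  have fin: "finite (Pow idx)" by (simp add: idx_def)
  have split: "superset_sum g S = g S + (\<Sum>T\<in>Pow idx - {S}. if S \<subseteq> T then g T else 0)" for g
    unfolding superset_sum_def using less.prems fin by (subst sum.remove[of _ S]) auto
  have "(\<Sum>T\<in>Pow idx - {S}. if S \<subseteq> T then e T else 0) = (\<Sum>T\<in>Pow idx - {S}. if S \<subseteq> T then e' T else 0)"
  proof (intro sum.cong refl if_cong)
    fix T assume T: "T \<in> Pow idx - {S}" "S \<subseteq> T"
    then have "idx - T \<subset> idx - S" using less.prems by blast
    then have "card (idx - T) < card (idx - S)" by (intro psubset_card_mono) (simp_all add: idx_def)
    then show "e T = e' T" using less.hyps T by blast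
  qed
  then show ?case using assms(1)[OF less.prems] split[of e] split[of e'] by simp
qed

definition slack :: "(nat \<Rightarrow> real) \<Rightarrow> nat \<Rightarrow> real" where
  "slack y i = (\<Sum>j<11. y j * coord (unit_rays ! j) i)"

lemma length_moebius_sets: "length moebius_sets = 11" by (simp add: moebius_sets_def)

lemma length_facets: "length facets = 12" by (simp add: facets_def)

lemma slack_unit: "i < 11 \<Longrightarrow> slack y i = y i"
proof -
  assume i: "i < 11"
  have "y j * coord (unit_rays ! j) i = (if j = i then y j else 0)" if "j < 11" for j
    using that i by (simp add: unit_rays_def coord_def nth_append length_facets)
  then show ?thesis using i by (simp add: slack_def)
qed

lemma slack_facet: "m < 12 \<Longrightarrow> slack y (11 + m) = (\<Sum>j<11. y j * of_int (facets ! m ! j))"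
  unfolding slack_def
  by (intro sum.cong refl) (simp add: unit_rays_def coord_def nth_append length_facets)

lemma slack_in_cone:
  assumes "\<And>j. j < 11 \<Longrightarrow> 0 \<le> y j"
  shows "slack y \<in> list_cone unit_rays"
proof -
  have "(\<lambda>i. \<Sum>j\<in>{..<11}. y j * coord (unit_rays ! j) i) \<in> list_cone unit_rays"
    using assms by (intro cone_sum[of _ "\<lambda>j. coord (unit_rays ! j)"] cone_generator imageI nth_mem)
      (auto simp: unit_rays_def)
  then show ?thesis unfolding slack_def[abs_def] .
qed

lemma moebius_coordinate_values:
  shows "moebius_coordinate e 0 = e {1,2} + e {1,2,3} + e {1,2,4} + e {1,2,3,4}"
    and "moebius_coordinate e 1 = e {1,3} + e {1,2,3} + e {1,3,4} + e {1,2,3,4}"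
    and "moebius_coordinate e 2 = e {1,4} + e {1,2,4} + e {1,3,4} + e {1,2,3,4}"
    and "moebius_coordinate e 3 = e {2,3} + e {1,2,3} + e {2,3,4} + e {1,2,3,4}"
    and "moebius_coordinate e 4 = e {2,4} + e {1,2,4} + e {2,3,4} + e {1,2,3,4}"
    and "moebius_coordinate e 5 = e {3,4} + e {1,3,4} + e {2,3,4} + e {1,2,3,4}"
    and "moebius_coordinate e 6 = e {2,3,4} + e {1,2,3,4}"
    and "moebius_coordinate e 7 = e {1,3,4} + e {1,2,3,4}"
    and "moebius_coordinate e 8 = e {1,2,4} + e {1,2,3,4}"
    and "moebius_coordinate e 9 = e {1,2,3} + e {1,2,3,4}"
    and "moebius_coordinate e 10 = e {1,2,3,4}"
  by (simp_all add: moebius_coordinate_def moebius_sets_def superset_sum_def[unfolded sum_Pow_idx])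

lemma facet_values:
  fixes y :: "nat \<Rightarrow> real"
  shows "(\<Sum>j<11. y j * of_int (facets ! 0 ! j)) = y 6 + y 7 + y 8 + y 9 - 2 * y 10"
    and "(\<Sum>j<11. y j * of_int (facets ! 1 ! j)) = y 0 + y 6 + y 7 - y 10"
    and "(\<Sum>j<11. y j * of_int (facets ! 2 ! j)) = y 1 + y 6 + y 8 - y 10"
    and "(\<Sum>j<11. y j * of_int (facets ! 3 ! j)) = y 2 + y 6 + y 9 - y 10"
    and "(\<Sum>j<11. y j * of_int (facets ! 4 ! j)) = y 3 + y 7 + y 8 - y 10"
    and "(\<Sum>j<11. y j * of_int (facets ! 5 ! j)) = y 4 + y 7 + y 9 - y 10"
    and "(\<Sum>j<11. y j * of_int (facets ! 6 ! j)) = y 5 + y 8 + y 9 - y 10"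
    and "(\<Sum>j<11. y j * of_int (facets ! 7 ! j)) = y 3 + y 4 + y 5 - y 6"
    and "(\<Sum>j<11. y j * of_int (facets ! 8 ! j)) = y 1 + y 2 + y 5 - y 7"
    and "(\<Sum>j<11. y j * of_int (facets ! 9 ! j)) = y 0 + y 2 + y 4 - y 8"
    and "(\<Sum>j<11. y j * of_int (facets ! 10 ! j)) = y 0 + y 1 + y 3 - y 9"
    and "(\<Sum>j<11. y j * of_int (facets ! 11 ! j)) = y 0 + y 1 + y 2 + y 3 + y 4 + y 5 - y 6 - y 7 - y 8 - y 9 + y 10"
  by (simp_all add: facets_def lessThan_nat_numeral)

lemma ratio_class_sum_zero: "(\<Sum>S\<in>Pow idx. ratio_class r S) = 0"
proof -
  have "(\<Sum>S\<in>Pow idx. ratio_class r S) = ratio_class r {} + (\<Sum>S\<in>Pow idx - {{}}. ratio_class r S)"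
    by (rule sum.remove) (simp_all add: idx_def)
  also have "(\<Sum>S\<in>Pow idx - {{}}. ratio_class r S) = (\<Sum>S\<in>Pow idx - {{}}. overall_exponent r S)"
    by (intro sum.cong refl) (simp add: ratio_class_def)
  finally show ?thesis by (simp add: ratio_class_def)
qed

text \<open>Each inequality comes from one growth rate: \<open>growth_rate_contains\<close> yields nonnegativity of the
coordinates, \<open>growth_rate_rank_two\<close> the first seven facets and \<open>growth_rate_meets\<close> the last five. For a
single index the first and the last kind yield opposite inequalities.\<close>

lemma bounded_ratio_inequalities:
  assumes r: "r \<in> minor_products \<times> minor_products" "bounded_ratio r"
  defines "e \<equiv> ratio_class r"
  shows "superset_sum e {} = 0"
    and "\<And>i. i \<in> idx \<Longrightarrow> superset_sum e {i} = 0"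
    and "\<And>m. m < 23 \<Longrightarrow> 0 \<le> slack (moebius_coordinate e) m"
proof -
  note growth = bounded_ratio_growth[OF r, folded e_def]
  have zero: "(\<Sum>S\<in>Pow idx. e S) = 0" unfolding e_def by (rule ratio_class_sum_zero)
  then show "superset_sum e {} = 0" by (simp add: superset_sum_def)
  have contains: "0 \<le> superset_sum e K" if "K \<subseteq> idx" "K \<noteq> {}" for K
  proof -
    have "(\<Sum>S\<in>Pow idx. e S * (if K \<subseteq> S then - 1 else 0)) = - superset_sum e K"
      unfolding superset_sum_def sum_negf[symmetric] by (intro sum.cong) auto
    then show ?thesis using growth[OF growth_rate_contains[OF that]] by simp
  qed
  have meets: "(\<Sum>S\<in>Pow idx. if S \<inter> K = {} then 0 else e S) \<le> 0" if "K \<subseteq> idx" "K \<noteq> {}" for K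
    using growth[OF growth_rate_meets[OF that]] by (simp add: if_distrib[of "\<lambda>u. _ * u"] cong: if_cong)
  show single: "superset_sum e {i} = 0" if "i \<in> idx" for i
  proof (rule antisym)
    have "superset_sum e {i} = (\<Sum>S\<in>Pow idx. if S \<inter> {i} = {} then 0 else e S)"
      unfolding superset_sum_def by (intro sum.cong) auto
    then show "superset_sum e {i} \<le> 0" using meets[of "{i}"] that by simp
    show "0 \<le> superset_sum e {i}" using contains[of "{i}"] that by simp
  qed
  let ?y = "moebius_coordinate e"
  have facet: "0 \<le> (\<Sum>j<11. ?y j * of_int (facets ! m ! j))" if m12: "m < 12" for m
  proof -
    have lineality: "e {} = - (e {1} + e {2} + e {3} + e {4} + e {1,2} + e {1,3} + e {1,4} + e {2,3} + e {2,4} + e {3,4}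
        + e {1,2,3} + e {1,2,4} + e {1,3,4} + e {2,3,4} + e {1,2,3,4})"
      "e {1} = - (e {1,2} + e {1,3} + e {1,4} + e {1,2,3} + e {1,2,4} + e {1,3,4} + e {1,2,3,4})"
      "e {2} = - (e {1,2} + e {2,3} + e {2,4} + e {1,2,3} + e {1,2,4} + e {2,3,4} + e {1,2,3,4})"
      "e {3} = - (e {1,3} + e {2,3} + e {3,4} + e {1,2,3} + e {1,3,4} + e {2,3,4} + e {1,2,3,4})"
      "e {4} = - (e {1,4} + e {2,4} + e {3,4} + e {1,2,4} + e {1,3,4} + e {2,3,4} + e {1,2,3,4})"
    proof -
      have "superset_sum e {1} = 0" "superset_sum e {2} = 0" "superset_sum e {3} = 0" "superset_sum e {4} = 0"
        by (rule single; simp add: idx_def)+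
      note sums = zero[unfolded sum_Pow_idx] this[unfolded superset_sum_def sum_Pow_idx, simplified]
      show "e {1} = - (e {1,2} + e {1,3} + e {1,4} + e {1,2,3} + e {1,2,4} + e {1,3,4} + e {1,2,3,4})"
        "e {2} = - (e {1,2} + e {2,3} + e {2,4} + e {1,2,3} + e {1,2,4} + e {2,3,4} + e {1,2,3,4})"
        "e {3} = - (e {1,3} + e {2,3} + e {3,4} + e {1,2,3} + e {1,3,4} + e {2,3,4} + e {1,2,3,4})"
        "e {4} = - (e {1,4} + e {2,4} + e {3,4} + e {1,2,4} + e {1,3,4} + e {2,3,4} + e {1,2,3,4})"
        using sums(2-5) by simp_all
      show "e {} = - (e {1} + e {2} + e {3} + e {4} + e {1,2} + e {1,3} + e {1,4} + e {2,3} + e {2,4} + e {3,4}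
        + e {1,2,3} + e {1,2,4} + e {1,3,4} + e {2,3,4} + e {1,2,3,4})"
        using sums(1) by simp
    qed
    have "m = 0 \<or> m = 1 \<or> m = 2 \<or> m = 3 \<or> m = 4 \<or> m = 5 \<or> m = 6 \<or> m = 7 \<or> m = 8 \<or> m = 9 \<or> m = 10 \<or> m = 11"
      using m12 by presburger
    then consider "m = 0" | "m = 1" | "m = 2" | "m = 3" | "m = 4" | "m = 5" | "m = 6" | "m = 7" | "m = 8" | "m = 9" | "m = 10" | "m = 11"
      by blast
    then show ?thesis
    proof cases
      case 1
      have "idx = {1, 2, 3, 4}" by (auto simp: idx_def)
      from growth[OF growth_rate_rank_two[OF this, of "-1"]] lineality show ?thesis
        unfolding 1 facet_values moebius_coordinate_values by (simp add: sum_Pow_idx; linarith)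
    next
      case 2
      have "idx = {3, 4, 1, 2}" by (auto simp: idx_def)
      from growth[OF growth_rate_rank_two[OF this, of "1"]] lineality show ?thesis
        unfolding 2 facet_values moebius_coordinate_values by (simp add: sum_Pow_idx; linarith)
    next
      case 3
      have "idx = {2, 4, 1, 3}" by (auto simp: idx_def)
      from growth[OF growth_rate_rank_two[OF this, of "1"]] lineality show ?thesis
        unfolding 3 facet_values moebius_coordinate_values by (simp add: sum_Pow_idx; linarith)
    next
      case 4
      have "idx = {2, 3, 1, 4}" by (auto simp: idx_def)
      from growth[OF growth_rate_rank_two[OF this, of "1"]] lineality show ?thesis
        unfolding 4 facet_values moebius_coordinate_values by (simp add: sum_Pow_idx; linarith)
    next
      case 5
      have "idx = {1, 4, 2, 3}" by (auto simp: idx_def)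
      from growth[OF growth_rate_rank_two[OF this, of "1"]] lineality show ?thesis
        unfolding 5 facet_values moebius_coordinate_values by (simp add: sum_Pow_idx; linarith)
    next
      case 6
      have "idx = {1, 3, 2, 4}" by (auto simp: idx_def)
      from growth[OF growth_rate_rank_two[OF this, of "1"]] lineality show ?thesis
        unfolding 6 facet_values moebius_coordinate_values by (simp add: sum_Pow_idx; linarith)
    next
      case 7
      have "idx = {1, 2, 3, 4}" by (auto simp: idx_def)
      from growth[OF growth_rate_rank_two[OF this, of "1"]] lineality show ?thesis
        unfolding 7 facet_values moebius_coordinate_values by (simp add: sum_Pow_idx; linarith)
    next
      case 8
      have "{2, 3, 4} \<subseteq> idx" by (simp add: idx_def)
      from growth[OF growth_rate_meets[OF this]] lineality show ?thesis
        unfolding 8 facet_values moebius_coordinate_values by (simp add: sum_Pow_idx; linarith)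
    next
      case 9
      have "{1, 3, 4} \<subseteq> idx" by (simp add: idx_def)
      from growth[OF growth_rate_meets[OF this]] lineality show ?thesis
        unfolding 9 facet_values moebius_coordinate_values by (simp add: sum_Pow_idx; linarith)
    next
      case 10
      have "{1, 2, 4} \<subseteq> idx" by (simp add: idx_def)
      from growth[OF growth_rate_meets[OF this]] lineality show ?thesis
        unfolding 10 facet_values moebius_coordinate_values by (simp add: sum_Pow_idx; linarith)
    next
      case 11
      have "{1, 2, 3} \<subseteq> idx" by (simp add: idx_def)
      from growth[OF growth_rate_meets[OF this]] lineality show ?thesis
        unfolding 11 facet_values moebius_coordinate_values by (simp add: sum_Pow_idx; linarith)
    next
      case 12
      have "{1, 2, 3, 4} \<subseteq> idx" by (simp add: idx_def)
      from growth[OF growth_rate_meets[OF this]] lineality show ?thesis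
        unfolding 12 facet_values moebius_coordinate_values by (simp add: sum_Pow_idx; linarith)
    qed
  qed
  show "0 \<le> slack ?y m" if m: "m < 23" for m
  proof (cases "m < 11")
    case True
    have "\<forall>K \<in> set moebius_sets. set K \<subseteq> idx \<and> set K \<noteq> {}" by (auto simp: moebius_sets_def idx_def)
    moreover have "moebius_sets ! m \<in> set moebius_sets" using True by (intro nth_mem) (simp add: length_moebius_sets)
    ultimately have "0 \<le> ?y m" using contains unfolding moebius_coordinate_def by blast
    then show ?thesis using slack_unit[OF True] by simp
  next
    case False
    obtain k where "m = 11 + k" "k < 12" using False m that[of "m - 11"] by simp
    then show ?thesis using facet slack_facet by simp
  qed
qed

lemma index_set_cases:
  assumes "K \<subseteq> idx"
  obtains "K = {}" | i where "K = {i}" "i \<in> idx" | i where "i < 11" "K = set (moebius_sets ! i)"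
proof -
  have "\<forall>K. K \<subseteq> {1, 2, 3, 4} \<longrightarrow> K = {} \<or> (\<exists>i\<in>{1, 2, 3, 4}. K = {i}) \<or> K \<in> set ` set moebius_sets"
    unfolding all_subset_insert moebius_sets_def by simp
  then have "K = {} \<or> (\<exists>i\<in>idx. K = {i}) \<or> K \<in> set ` set moebius_sets"
    using assms unfolding idx_def by blast
  moreover have "\<exists>i<11. L = moebius_sets ! i" if "L \<in> set moebius_sets" for L
    using that by (metis in_set_conv_nth length_moebius_sets)
  ultimately show thesis using that by blast
qed

lemma ratio_class_outside:
  assumes "r \<in> minor_products \<times> minor_products" "\<not> S \<subseteq> idx"
  shows "ratio_class r S = 0"
proof -
  have "product_exponent \<alpha> S = 0" if "\<alpha> \<in> minor_products" for \<alpha>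
    using that assms(2) by (induction \<alpha>) (auto simp: product_exponent_def minor_products_def split: if_splits)
  then show ?thesis using assms by (auto simp: ratio_class_def overall_exponent_def)
qed

text \<open>The remaining superset sums vanish for bounded ratios, so the 11 coordinates determine the class.\<close>

lemma bounded_ratio_class_eqI:
  assumes r: "r \<in> minor_products \<times> minor_products" "bounded_ratio r"
    and s: "s \<in> minor_products \<times> minor_products" "bounded_ratio s"
    and eq: "\<And>i. i < 11 \<Longrightarrow> moebius_coordinate (ratio_class r) i = moebius_coordinate (ratio_class s) i"
  shows "ratio_class r = ratio_class s"
proof
  fix S
  have "superset_sum (ratio_class r) K = superset_sum (ratio_class s) K" if "K \<subseteq> idx" for K
    using that
  proof (cases rule: index_set_cases)
    case 1
    then show ?thesis using bounded_ratio_inequalities(1)[OF r] bounded_ratio_inequalities(1)[OF s] by simp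
  next
    case (2 i)
    then show ?thesis using bounded_ratio_inequalities(2)[OF r] bounded_ratio_inequalities(2)[OF s] by simp
  next
    case (3 i)
    then show ?thesis using eq[of i] by (simp add: moebius_coordinate_def)
  qed
  then show "ratio_class r S = ratio_class s S"
    using superset_sums_determine ratio_class_outside[OF r(1)] ratio_class_outside[OF s(1)]
    by (cases "S \<subseteq> idx") auto
qed

text \<open>The superset sums of the exponents of a product, read off from its list of factors.\<close>

definition product_superset_sum :: "minor_product \<Rightarrow> nat set \<Rightarrow> real" where
  "product_superset_sum \<alpha> K = (\<Sum>(T, \<eta>)\<leftarrow>\<alpha>. if T \<subseteq> idx \<and> K \<subseteq> T then \<eta> else 0)"

lemma sum_product_exponent:
  "(\<Sum>S\<in>Pow idx. if K \<subseteq> S then product_exponent \<alpha> S else 0) = product_superset_sum \<alpha> K"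
proof (induction \<alpha>)
  case (Cons p \<alpha>)
  obtain T \<eta> where p: "p = (T, \<eta>)" by (cases p)
  have fin: "finite (Pow idx)" by (simp add: idx_def)
  have "(\<Sum>S\<in>Pow idx. if K \<subseteq> S then product_exponent (p # \<alpha>) S else 0) =
     (\<Sum>S\<in>Pow idx. (if T = S then (if K \<subseteq> T then \<eta> else 0) else 0) + (if K \<subseteq> S then product_exponent \<alpha> S else 0))"
    by (intro sum.cong refl) (auto simp: p product_exponent_Cons)
  also have "\<dots> = product_superset_sum (p # \<alpha>) K"
    unfolding sum.distrib Cons.IH using fin by (simp add: p product_superset_sum_def)
  finally show ?case .
qed (simp add: product_exponent_def product_superset_sum_def)

lemma superset_sum_ratio_class:
  assumes "K \<noteq> {}"
  shows "superset_sum (ratio_class r) K = product_superset_sum (fst r) K - product_superset_sum (snd r) K"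
proof -
  have "superset_sum (ratio_class r) K = (\<Sum>S\<in>Pow idx. (if K \<subseteq> S then product_exponent (fst r) S else 0)
      - (if K \<subseteq> S then product_exponent (snd r) S else 0))"
    unfolding superset_sum_def using assms
    by (intro sum.cong refl) (auto simp: ratio_class_def overall_exponent_def)
  then show ?thesis by (simp add: sum_subtractf sum_product_exponent)
qed

lemma superset_sum_mult_power:
  assumes "K \<noteq> {}"
  shows "superset_sum (ratio_class (ratio_mult (ratio_power g t) r)) K =
    t * superset_sum (ratio_class g) K + superset_sum (ratio_class r) K"
proof -
  have "product_superset_sum (map (\<lambda>(S, \<eta>). (S, t * \<eta>)) \<alpha> @ \<beta>) K =
      t * product_superset_sum \<alpha> K + product_superset_sum \<beta> K" for \<alpha> \<beta>
    by (induction \<alpha>) (auto simp: product_superset_sum_def algebra_simps)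
  then show ?thesis
    by (simp add: superset_sum_ratio_class[OF assms] ratio_mult_def ratio_power_def algebra_simps)
qed

lemma product_superset_sum_plain:
  assumes "\<And>S. S \<in> set Ss \<Longrightarrow> set S \<subseteq> idx"
  shows "product_superset_sum (map (\<lambda>S. (S, 1)) (map set Ss)) (set K) = of_int (count_supersets K Ss)"
  using assms
  by (induction Ss) (auto simp: product_superset_sum_def count_supersets_def list_all_iff subset_iff)

lemma moebius_sets_nonempty: "i < 11 \<Longrightarrow> set (moebius_sets ! i) \<noteq> {}"
proof -
  assume "i < 11"
  then have "moebius_sets ! i \<in> set moebius_sets" by (intro nth_mem) (simp add: moebius_sets_def)
  then show ?thesis by (auto simp: moebius_sets_def)
qed

lemma basic_lists_basic:
  assumes "(num, den) \<in> set basic_lists"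
  shows "plain_ratio (map set num) (map set den) \<in> basic_ratios"
    and "S \<in> set num \<union> set den \<Longrightarrow> set S \<subseteq> idx"
  using assms by (auto simp: basic_lists_def basic_ratios_def idx_def)

lemma list_symmetry:
  assumes "p \<in> set permutation_lists"
  obtains f where "f \<in> index_symmetries"
    "\<And>S. set S \<subseteq> idx \<Longrightarrow> f (set S) = set (list_symmetry compl p S)"
proof -
  have p: "length p = 4" "set p \<subseteq> idx" "distinct p"
    using assms by (auto simp: permutation_lists_def set_n_lists idx_def)
  define \<sigma> where "\<sigma> i = (if i \<in> idx then p ! (i - 1) else i)" for i
  have "\<sigma> permutes idx"
  proof (rule bij_imp_permutes)
    have i1: "i - 1 < 4" if "i \<in> idx" for i using that by (auto simp: idx_def)
    have inj: "inj_on \<sigma> idx"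
    proof (rule inj_onI)
      fix i j assume ij: "i \<in> idx" "j \<in> idx" "\<sigma> i = \<sigma> j"
      then have "i - 1 = j - 1" using p i1 nth_eq_iff_index_eq[OF p(3)] by (auto simp: \<sigma>_def)
      then show "i = j" using ij by (auto simp: idx_def)
    qed
    moreover have "\<sigma> ` idx \<subseteq> idx" using p i1 by (auto simp: \<sigma>_def)
    moreover have "finite idx" by (simp add: idx_def)
    ultimately show "bij_betw \<sigma> idx idx"
      using endo_inj_surj by (simp add: bij_betw_def)
  qed (simp add: \<sigma>_def)
  then have sym: "(\<lambda>S. \<sigma> ` S) \<in> index_symmetries" "(\<lambda>S. idx - \<sigma> ` S) \<in> index_symmetries"
    by (auto simp: index_symmetries_def)
  have img: "\<sigma> ` set S = (\<lambda>i. p ! (i - 1)) ` set S" if "set S \<subseteq> idx" for S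
    using that by (intro image_cong refl) (auto simp: \<sigma>_def)
  show thesis
  proof (cases compl)
    case True
    then have "idx - \<sigma> ` set S = set (list_symmetry compl p S)" if "set S \<subseteq> idx" for S
      unfolding img[OF that] by (auto simp: list_symmetry_def Let_def idx_def)
    then show thesis by (rule that[OF sym(2)])
  next
    case False
    then have "\<sigma> ` set S = set (list_symmetry compl p S)" if "set S \<subseteq> idx" for S
      unfolding img[OF that] by (simp add: list_symmetry_def Let_def)
    then show thesis by (rule that[OF sym(1)])
  qed
qed

lemma generator_coordinates_generator:
  assumes "p \<in> set permutation_lists" "(num, den) \<in> set basic_lists"
  obtains g where "g \<in> generators4"
    "\<And>i. i < 11 \<Longrightarrow> moebius_coordinate (ratio_class g) i = of_int (generator_coordinates (compl, p, num, den) ! i)"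
proof -
  obtain f where f: "f \<in> index_symmetries"
    and fS: "\<And>S. set S \<subseteq> idx \<Longrightarrow> f (set S) = set (list_symmetry compl p S)"
    using list_symmetry[OF assms(1)] by blast
  let ?s = "list_symmetry compl p"
  define g where "g = reindex f (plain_ratio (map set num) (map set den))"
  have sub: "set (?s S) \<subseteq> idx" if "S \<in> set num \<union> set den" for S
    using index_symmetries_subset[OF f] basic_lists_basic(2)[OF assms(2) that] fS by metis
  have "map (f \<circ> set) num = map set (map ?s num)" "map (f \<circ> set) den = map set (map ?s den)"
    using fS basic_lists_basic(2)[OF assms(2)] by auto
  then have g: "fst g = map (\<lambda>S. (S, 1)) (map set (map ?s num))" "snd g = map (\<lambda>S. (S, 1)) (map set (map ?s den))"
    by (simp_all add: g_def reindex_def plain_ratio_def o_def)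
  have "moebius_coordinate (ratio_class g) i = of_int (generator_coordinates (compl, p, num, den) ! i)" if i: "i < 11" for i
  proof -
    have len: "i < length moebius_sets" using i by (simp add: moebius_sets_def)
    have "product_superset_sum (fst g) (set (moebius_sets ! i)) = of_int (count_supersets (moebius_sets ! i) (map ?s num))"
      "product_superset_sum (snd g) (set (moebius_sets ! i)) = of_int (count_supersets (moebius_sets ! i) (map ?s den))"
      unfolding g by (intro product_superset_sum_plain; use sub in auto)+
    then show ?thesis
      using len by (simp add: moebius_coordinate_def superset_sum_ratio_class[OF moebius_sets_nonempty[OF i]]
          generator_coordinates_def Let_def)
  qed
  moreover have "g \<in> generators4"
    unfolding generators4_def g_def using f basic_lists_basic(1)[OF assms(2)] by blast
  ultimately show thesis using that by blast
qed

text \<open>Adding a multiple of a generator in the cone corresponds to multiplying by a power of a ratio.\<close>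

lemma cone_of_generators:
  assumes R: "\<And>r. r \<in> set R \<Longrightarrow> \<exists>g\<in>generators4. \<forall>i<11. moebius_coordinate (ratio_class g) i = coord r i"
    and x: "x \<in> list_cone R"
  shows "\<exists>\<rho>\<in>power_products generators4. \<forall>i<11. moebius_coordinate (ratio_class \<rho>) i = x i"
  using x
proof induction
  case cone_zero
  have "moebius_coordinate (ratio_class ([], [])) i = 0" if "i < 11" for i
    by (simp add: moebius_coordinate_def superset_sum_ratio_class[OF moebius_sets_nonempty[OF that]]
        product_superset_sum_def)
  then show ?case using power_products.one by blast
next
  case (cone_add r a x)
  then obtain \<rho> where \<rho>: "\<rho> \<in> power_products generators4" "\<forall>i<11. moebius_coordinate (ratio_class \<rho>) i = x i"
    by blast
  obtain g where g: "g \<in> generators4" "\<forall>i<11. moebius_coordinate (ratio_class g) i = r i"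
  proof -
    obtain u where "u \<in> set R" "r = coord u" using cone_add(1) by blast
    then show thesis using R that by blast
  qed
  show ?case
  proof (cases "a = 0")
    case True
    then show ?thesis using \<rho> by auto
  next
    case False
    then have "ratio_mult (ratio_power g a) \<rho> \<in> power_products generators4"
      using cone_add(2) by (intro power_products.mult g \<rho>) simp
    moreover have "moebius_coordinate (ratio_class (ratio_mult (ratio_power g a) \<rho>)) i = a * r i + x i" if "i < 11" for i
      using g(2) \<rho>(2) that superset_sum_mult_power[OF moebius_sets_nonempty[OF that]]
      by (simp add: moebius_coordinate_def)
    ultimately show ?thesis by blast
  qed
qed

lemma bounded_ratio_class_generated:
  assumes r: "r \<in> minor_products \<times> minor_products" "bounded_ratio r"
  shows "ratio_class r \<in> ratio_class ` power_products generators4"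
proof -
  let ?y = "moebius_coordinate (ratio_class r)"
  obtain R where run: "dd_run [11..<23] unit_rays = Some R"
    using dd_certificate unfolding dd_certificate_def by (cases "dd_run [11..<23] unit_rays") simp_all
  have R: "take 11 u \<in> generator_coordinates `
      set (List.product [False, True] (List.product permutation_lists basic_lists))" if "u \<in> set R" for u
    using dd_certificate that unfolding dd_certificate_def run option.case Let_def list_all_iff set_map by blast
  have nonneg: "0 \<le> slack ?y i" if "i < 23" for i by (rule bounded_ratio_inequalities(3)[OF r that])
  have "slack ?y \<in> list_cone R"
  proof (rule dd_run_sound[OF run, of 23])
    show "slack ?y \<in> list_cone unit_rays"
    proof (rule slack_in_cone)
      fix j :: nat assume "j < 11"
      then show "0 \<le> ?y j" using nonneg[of j] slack_unit[of j ?y] by simp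
    qed
    show "length u = 23" if "u \<in> set unit_rays" for u
      using that by (auto simp: unit_rays_def length_facets)
  qed (use nonneg in auto)
  moreover have "\<exists>g\<in>generators4. \<forall>i<11. moebius_coordinate (ratio_class g) i = coord u i" if u: "u \<in> set R" for u
  proof -
    obtain compl p num den where p: "p \<in> set permutation_lists" "(num, den) \<in> set basic_lists"
      and take: "take 11 u = generator_coordinates (compl, p, num, den)"
      using R[OF u] by auto
    have len: "length (generator_coordinates (compl, p, num, den)) = 11"
      by (simp add: generator_coordinates_def Let_def moebius_sets_def)
    have "coord u i = of_int (generator_coordinates (compl, p, num, den) ! i)" if "i < 11" for i
      using that len unfolding take[symmetric] by (simp add: coord_def)
    then show ?thesis using generator_coordinates_generator[OF p, of compl] by metis
  qed
  ultimately obtain \<rho> where \<rho>: "\<rho> \<in> power_products generators4"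
    and coords: "\<forall>i<11. moebius_coordinate (ratio_class \<rho>) i = slack ?y i"
    using cone_of_generators by blast
  have "ratio_class r = ratio_class \<rho>"
    using power_products_bounded[OF \<rho>] coords slack_unit by (intro bounded_ratio_class_eqI r) auto
  then show ?thesis using \<rho> by blast
qed

theorem theorem8:
  shows "bounded_ratios4 = ratio_class ` power_products generators4"
  using bounded_ratio_class_generated power_products_bounded
  unfolding bounded_ratios4_def by blast

end
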